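(* Let $f_1,\dots,f_N:\mathbb{R}^n\to\mathbb{R}$ be lower semicontinuous convex functions and $f=\sum_{i=1}^N f_i$. Suppose the following hold. (A1) The set $X^*=\arg\min_{x\in\mathbb{R}^n} f(x)$ is nonempty, and there is a constant $l$ such that $\|g\|\le l$ for all $i\in\mathcal{V}=\{1,\dots,N\}$, all $x\in\mathrm{dom}(f_i)$ and all $g\in\partial f_i(x)$. (A2) $\{\mathcal{G}_1,\dots,\mathcal{G}_m\}$ is a finite set of weighted directed graphs on node set $\mathcal{V}$, each with a doubly stochastic adjacency matrix $A_{\mathcal{G}_r}$; the union graph with edge set $\bigcup_{r=1}^m\mathcal{E}_{\mathcal{G}_r}$ is strongly connected; and $\theta(k)$, $k=0,1,2,\dots$, is an irreducible Markov chain on $\{1,\dots,m\}$ with stationary (time-homogeneous) transition matrix $P$. (A3) $\alpha_k=\dfrac{a_1}{(k+1)^{\delta_1}}$ and $\beta_k=\dfrac{a_2}{(k+1)^{\delta_2}}$ with $a_1>0$, $a_2>0$, $0<\delta_1<\delta_2\le 1$ and $\delta_2-\delta_1\ge\frac12$. Let $x_i(k)$, $i\in\mathcal{V}$, be generated from initial states $x_i(0)\in\mathbb{R}^n$ by $$x_i(k+1)=x_i(k)+\alpha_k\sum_{j=1}^N a_{ij}(k)\,(x_j(k)-x_i(k))-\beta_k d_i(k),\qquad k=0,1,2,\dots,$$ where $a_{ij}(k)$ is the $(i,j)$ entry of $A_{\mathcal{G}_{\theta(k)}}$ and $d_i(k)\in\partial f_i(x_i(k))$. Let $y(k)=\frac1N\sum_{i=1}^N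 x_i(k)$. Then: 1) For every $i\in\mathcal{V}$, $\lim_{k\to\infty}\|x_i(k)-y(k)\|=0$ almost surely. 2) For every $i\in\mathcal{V}$, $\sum_{k=1}^\infty\beta_k\|y(k)-x_i(k)\|<\infty$ almost surely.
   Context: A weighted directed graph $\mathcal{G}=\{\mathcal{V},\mathcal{E}_{\mathcal{G}},A_{\mathcal{G}}\}$ has node set $\mathcal{V}=\{1,\dots,N\}$, edge set $\mathcal{E}_{\mathcal{G}}\subset\mathcal{V}\times\mathcal{V}$ and a nonnegative row stochastic adjacency matrix $A_{\mathcal{G}}=[a_{ij}]\in\mathbb{R}^{N\times N}$ with $0<a_{ij}\le1$ if $(j,i)\in\mathcal{E}_{\mathcal{G}}$ and $a_{ij}=0$ otherwise. A matrix is doubly stochastic if it is nonnegative and all its row sums and column sums equal 1. A directed graph is strongly connected if for any two nodes there is a directed path from each to the other. $\partial f_i(x)$ is the convex subdifferential and $\|\cdot\|$ is the Euclidean norm. The initial states $x_i(0)$ are deterministic. All randomness is on one probability space carrying the Markov chain $\theta(k)$; the initial distribution of $\theta(0)$ is arbitrary, and $d_i(k)$ is any subgradient selection for which $x_i(k)$, $d_i(k)$ are random vectors. *)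

theory Defs
  imports "HOL-Probability.Probability" "Graph_Theory.Digraph_Component"
begin

definition row_stochastic :: "real^'n^'n \<Rightarrow> bool" where
  "row_stochastic A \<longleftrightarrow> (\<forall>i j. 0 \<le> A $ i $ j) \<and> (\<forall>i. (\<Sum>j\<in>UNIV. A $ i $ j) = 1)"

definition doubly_stochastic :: "real^'n^'n \<Rightarrow> bool" where
  "doubly_stochastic A \<longleftrightarrow>
     (\<forall>i j. 0 \<le> A $ i $ j) \<and> (\<forall>i. (\<Sum>j\<in>UNIV. A $ i $ j) = 1) \<and> (\<forall>j. (\<Sum>i\<in>UNIV. A $ i $ j) = 1)"

(* The node set is the whole (finite, nonempty) type 'v. *)
record 'v wgraph =
  edges :: "('v \<times> 'v) set"
  adjacency :: "real^'v^'v"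

(* Row i of the adjacency matrix holds the weights of the edges (j, i) entering node i. *)
definition weighted_digraph :: "('v::finite) wgraph \<Rightarrow> bool" where
  "weighted_digraph G \<longleftrightarrow> row_stochastic (adjacency G) \<and>
     (\<forall>i j. ((j, i) \<in> edges G \<longrightarrow> 0 < adjacency G $ i $ j \<and> adjacency G $ i $ j \<le> 1) \<and>
            ((j, i) \<notin> edges G \<longrightarrow> adjacency G $ i $ j = 0))"

definition union_graph :: "('m \<Rightarrow> ('v::finite) wgraph) \<Rightarrow> ('v, 'v \<times> 'v) pre_digraph" where
  "union_graph G = \<lparr>verts = UNIV, arcs = (\<Union>r. edges (G r)), tail = fst, head = snd\<rparr>"

(* (^) on real^'m^'m is the entrywise power, hence the iterated matrix product. *)
definition matrix_power :: "real^'m^'m \<Rightarrow> nat \<Rightarrow> real^'m^'m" where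
  "matrix_power P t = ((\<lambda>B. P ** B) ^^ t) (mat 1)"

definition irreducible_matrix :: "real^'m^'m \<Rightarrow> bool" where
  "irreducible_matrix P \<longleftrightarrow> (\<forall>r s. \<exists>t. matrix_power P t $ r $ s > 0)"

(* Time-homogeneous Markov chain on the finite type 'm with transition matrix P and arbitrary
   initial distribution; s ranges over trajectories, of which only s 0, ..., s (k + 1) matter. *)
definition markov_chain :: "'w measure \<Rightarrow> (nat \<Rightarrow> 'w \<Rightarrow> 'm::finite) \<Rightarrow> real^'m^'m \<Rightarrow> bool" where
  "markov_chain M \<theta> P \<longleftrightarrow> row_stochastic P \<and>
     (\<forall>k. \<theta> k \<in> M \<rightarrow>\<^sub>M count_space UNIV) \<and>
     (\<forall>k s. \<P>(\<omega> in M. \<forall>t\<le>k. \<theta> t \<omega> = s t) > 0 \<longrightarrow>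
        \<P>(\<omega> in M. \<theta> (Suc k) \<omega> = s (Suc k) \<bar> \<forall>t\<le>k. \<theta> t \<omega> = s t) = P $ s k $ s (Suc k))"

definition lower_semicontinuous :: "('a::topological_space \<Rightarrow> real) \<Rightarrow> bool" where
  "lower_semicontinuous f \<longleftrightarrow> (\<forall>x. ereal (f x) \<le> Liminf (at x) (\<lambda>z. ereal (f z)))"

definition subdifferential :: "('a::real_inner \<Rightarrow> real) \<Rightarrow> 'a \<Rightarrow> 'a set" where
  "subdifferential f x = {g. \<forall>z. f z \<ge> f x + g \<bullet> (z - x)}"

end

theory Submission
  imports Defs "HOL-Real_Asymp.Real_Asymp"
begin

text \<open>
The disagreement vector \<open>E\<close> with entries \<open>x i - y\<close> performs a noisy Laplacian step of size
\<open>\<alpha> k\<close> with noise of order \<open>\<beta> k\<close>.  Since \<open>\<alpha> k\<close> tends to zero, \<open>E\<close> barely moves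
during a window of bounded length, so a window in which the chain visits every state behaves like
one step on the union graph and contracts the norm of \<open>E\<close> by a factor \<open>1 - c * \<alpha> k\<close>; all
other windows are nonexpansive up to the noise.  By irreducibility a window visits all states with
conditional probability at least \<open>p > 0\<close> given the past, so the mean \<open>W\<close> of a dominating
scalar recursion satisfies \<open>W (n + 1) \<le> (1 - p c \<alpha> n) W n + O(\<beta> n)\<close>.  Multiplying by the decreasing
ratio \<open>\<beta> / \<alpha>\<close> and telescoping bounds the sum of \<open>\<beta> n * W n\<close> by a multiple of the sum of
\<open>\<beta> n ^ 2 / \<alpha> n\<close>, which is finite because \<open>2 * \<delta>2 - \<delta>1 > 1\<close>.  Convergence to zero then
follows along each trajectory: \<open>norm E\<close> squared grows by summable amounts, hence converges, and
the sum of \<open>\<beta> k * norm (E k)\<close> is finite while that of \<open>\<beta> k\<close> is not.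
\<close>

subsection \<open>Laplacians of doubly stochastic matrices\<close>

text \<open>This is I - A acting on the node index when the rows of \<open>A\<close> sum to one.
  Entries in an arbitrary vector space let all node states form a single vector, so that one norm
  measures the distance from consensus.\<close>

definition laplacian :: "real^'v^'v \<Rightarrow> 'a::real_vector^'v \<Rightarrow> 'a^'v" where
  "laplacian A u = (\<chi> i. \<Sum>j\<in>UNIV. A $ i $ j *\<^sub>R (u $ i - u $ j))"

text \<open>For doubly stochastic \<open>A\<close>, symmetric or not, this is twice the quadratic
  form of the Laplacian, see \<open>inner_laplacian\<close>.\<close>

definition disagreement :: "real^'v^'v \<Rightarrow> 'a::real_normed_vector^'v \<Rightarrow> real" where
  "disagreement A u = (\<Sum>i\<in>UNIV. \<Sum>j\<in>UNIV. A $ i $ j * (norm (u $ i - u $ j))\<^sup>2)"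

lemma doubly_stochasticD:
  assumes "doubly_stochastic A"
  shows "0 \<le> A $ i $ j" "(\<Sum>j\<in>UNIV. A $ i $ j) = 1" "(\<Sum>i\<in>UNIV. A $ i $ j) = 1"
  using assms by (auto simp: doubly_stochastic_def)

lemma laplacian_diff: "laplacian A (u - v) = laplacian A u - laplacian A v"
  by (simp add: laplacian_def vec_eq_iff flip: sum_subtractf scaleR_diff_right)
     (simp add: algebra_simps)

text \<open>Unit row sums reduce one of the two double sums to the plain sum of \<open>z\<close>,
  unit column sums the other. Hence the consensus term does not move the average of the
  nodes.\<close>

lemma sum_laplacian_eq_0:
  fixes z :: "'v::finite \<Rightarrow> 'a::real_vector"
  assumes "doubly_stochastic A"
  shows "(\<Sum>i\<in>UNIV. \<Sum>j\<in>UNIV. A $ i $ j *\<^sub>R (z j - z i)) = 0"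
proof -
  have "(\<Sum>i\<in>UNIV. \<Sum>j\<in>UNIV. A $ i $ j *\<^sub>R z j) = (\<Sum>j\<in>UNIV. z j)"
    by (subst sum.swap) (simp add: doubly_stochasticD[OF assms] flip: scaleR_sum_left)
  moreover have "(\<Sum>i\<in>UNIV. \<Sum>j\<in>UNIV. A $ i $ j *\<^sub>R z i) = (\<Sum>i\<in>UNIV. z i)"
    by (simp add: doubly_stochasticD[OF assms] flip: scaleR_sum_left)
  ultimately show ?thesis by (simp add: scaleR_diff_right sum_subtractf)
qed

lemma norm_vec_power2: "(norm (u :: 'a::real_normed_vector^'v))\<^sup>2 = (\<Sum>i\<in>UNIV. (norm (u $ i))\<^sup>2)"
  by (simp add: norm_vec_def L2_set_def sum_nonneg)

lemma doubly_stochastic_weighted_sums: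
  assumes "doubly_stochastic A"
  shows "(\<Sum>i\<in>UNIV. \<Sum>j\<in>UNIV. A $ i $ j * g i) = (\<Sum>i\<in>UNIV. g i)"
    and "(\<Sum>i\<in>UNIV. \<Sum>j\<in>UNIV. A $ i $ j * g j) = (\<Sum>i\<in>UNIV. g i)"
proof -
  show "(\<Sum>i\<in>UNIV. \<Sum>j\<in>UNIV. A $ i $ j * g i) = (\<Sum>i\<in>UNIV. g i)"
    by (simp add: doubly_stochasticD[OF assms] flip: sum_distrib_right)
  show "(\<Sum>i\<in>UNIV. \<Sum>j\<in>UNIV. A $ i $ j * g j) = (\<Sum>i\<in>UNIV. g i)"
    by (subst sum.swap) (simp add: doubly_stochasticD[OF assms] flip: sum_distrib_right)
qed

lemma disagreement_nonneg: "doubly_stochastic A \<Longrightarrow> 0 \<le> disagreement A u"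
  unfolding disagreement_def by (intro sum_nonneg mult_nonneg_nonneg) (auto simp: doubly_stochasticD)

lemma disagreement_le:
  fixes u :: "'a::real_normed_vector^'v"
  assumes "doubly_stochastic A"
  shows "disagreement A u \<le> 4 * (norm u)\<^sup>2"
proof -
  have sq: "(norm (a - b))\<^sup>2 \<le> 2 * (norm a)\<^sup>2 + 2 * (norm b)\<^sup>2" for a b :: 'a
  proof -
    have "(norm (a - b))\<^sup>2 \<le> (norm a + norm b)\<^sup>2"
      by (intro power_mono norm_triangle_ineq4) auto
    also have "\<dots> \<le> 2 * (norm a)\<^sup>2 + 2 * (norm b)\<^sup>2"
      using sum_squares_bound[of "norm a" "norm b"] by (simp add: power2_sum)
    finally show ?thesis .
  qed
  have "disagreement A u \<le> (\<Sum>i\<in>UNIV. \<Sum>j\<in>UNIV. A $ i $ j * (2 * (norm (u $ i))\<^sup>2 + 2 * (norm (u $ j))\<^sup>2))"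
    unfolding disagreement_def
    by (intro sum_mono mult_left_mono sq) (auto simp: doubly_stochasticD[OF assms])
  also have "\<dots> = (\<Sum>i\<in>UNIV. \<Sum>j\<in>UNIV. A $ i $ j * (2 * (norm (u $ i))\<^sup>2))
      + (\<Sum>i\<in>UNIV. \<Sum>j\<in>UNIV. A $ i $ j * (2 * (norm (u $ j))\<^sup>2))"
    by (simp add: distrib_left sum.distrib)
  also have "\<dots> = 4 * (norm u)\<^sup>2"
    by (simp only: doubly_stochastic_weighted_sums[OF assms, where g = "\<lambda>i. 2 * (norm (u $ i))\<^sup>2"])
       (simp add: norm_vec_power2 flip: sum_distrib_left)
  finally show ?thesis .
qed

text \<open>Jensen's inequality for the squared norm: the gap between the two sides is the weighted
  variance around the mean \<open>m\<close>.\<close>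

lemma norm_weighted_mean_power2_le:
  fixes w :: "'i \<Rightarrow> 'a::real_inner"
  assumes "\<And>j. j \<in> S \<Longrightarrow> 0 \<le> p j" "sum p S = 1"
  shows "(norm (\<Sum>j\<in>S. p j *\<^sub>R w j))\<^sup>2 \<le> (\<Sum>j\<in>S. p j * (norm (w j))\<^sup>2)"
proof -
  define m where "m = (\<Sum>j\<in>S. p j *\<^sub>R w j)"
  have mm: "m \<bullet> m = (\<Sum>j\<in>S. p j * (w j \<bullet> m))"
    by (subst (1) m_def) (simp add: inner_sum_left)
  have "0 \<le> (\<Sum>j\<in>S. p j * (norm (w j - m))\<^sup>2)"
    using assms by (intro sum_nonneg) auto
  also have "\<dots> = (\<Sum>j\<in>S. p j * (norm (w j))\<^sup>2 - 2 * ((p j *\<^sub>R w j) \<bullet> m) + p j * (m \<bullet> m))"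
    by (intro sum.cong) (auto simp: power2_norm_eq_inner inner_diff algebra_simps inner_commute)
  also have "\<dots> = (\<Sum>j\<in>S. p j * (norm (w j))\<^sup>2) - 2 * (m \<bullet> m) + m \<bullet> m"
    by (simp add: sum.distrib sum_subtractf assms(2) mm flip: sum_distrib_left sum_distrib_right)
  finally show ?thesis by (simp add: m_def power2_norm_eq_inner)
qed

text \<open>Expanding the squares leaves the cross term \<open>C\<close> and two diagonal sums, one
  weighted by rows and one by columns. Double stochasticity makes both equal to the squared norm of
  \<open>u\<close>.\<close>

lemma inner_laplacian:
  fixes u :: "'a::real_inner^'v"
  assumes "doubly_stochastic A"
  shows "2 * (u \<bullet> laplacian A u) = disagreement A u"
proof -
  define C where "C = (\<Sum>i\<in>UNIV. \<Sum>j\<in>UNIV. A $ i $ j * (u $ i \<bullet> u $ j))"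
  have "disagreement A u = (\<Sum>i\<in>UNIV. \<Sum>j\<in>UNIV. A $ i $ j * (norm (u $ i))\<^sup>2)
      + (\<Sum>i\<in>UNIV. \<Sum>j\<in>UNIV. A $ i $ j * (norm (u $ j))\<^sup>2) - 2 * C"
    unfolding disagreement_def C_def power2_norm_eq_inner inner_diff
    by (simp add: algebra_simps inner_commute sum.distrib sum_subtractf sum_distrib_left)
  also have "\<dots> = 2 * (norm u)\<^sup>2 - 2 * C"
    by (simp only: doubly_stochastic_weighted_sums[OF assms, where g = "\<lambda>i. (norm (u $ i))\<^sup>2"])
       (simp add: norm_vec_power2)
  finally have 1: "disagreement A u = 2 * (norm u)\<^sup>2 - 2 * C" .
  have "u \<bullet> laplacian A u = (\<Sum>i\<in>UNIV. \<Sum>j\<in>UNIV. A $ i $ j * (norm (u $ i))\<^sup>2) - C"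
    unfolding C_def laplacian_def inner_vec_def power2_norm_eq_inner
    by (simp add: inner_sum_right inner_diff sum_subtractf algebra_simps)
  also have "\<dots> = (norm u)\<^sup>2 - C"
    by (simp only: doubly_stochastic_weighted_sums[OF assms, where g = "\<lambda>i. (norm (u $ i))\<^sup>2"])
       (simp add: norm_vec_power2)
  finally show ?thesis using 1 by simp
qed

text \<open>Entry \<open>i\<close> of the Laplacian is the mean of the differences
  \<open>u $ i - u $ j\<close> under the weights of row \<open>i\<close>, so Jensen applies row by
  row.\<close>

lemma norm_laplacian_power2_le:
  fixes u :: "'a::real_inner^'v"
  assumes "doubly_stochastic A"
  shows "(norm (laplacian A u))\<^sup>2 \<le> disagreement A u"
  unfolding norm_vec_power2 disagreement_def laplacian_def vec_lambda_beta
  by (intro sum_mono norm_weighted_mean_power2_le) (auto simp: doubly_stochasticD[OF assms])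

lemma norm_laplacian_le:
  fixes u :: "'a::real_inner^'v"
  assumes "doubly_stochastic A"
  shows "norm (laplacian A u) \<le> 2 * norm u"
proof (rule power2_le_imp_le)
  show "(norm (laplacian A u))\<^sup>2 \<le> (2 * norm u)\<^sup>2"
    using norm_laplacian_power2_le[OF assms, of u] disagreement_le[OF assms, of u]
    by (simp add: power_mult_distrib)
qed auto

text \<open>In the expanded square the cross term is exactly \<open>- a * disagreement A u\<close>,
  and the quadratic term is at most the square of \<open>a\<close> times the same
  disagreement.\<close>

lemma norm_laplacian_step_power2_le:
  fixes u :: "'a::real_inner^'v"
  assumes "doubly_stochastic A" "0 \<le> a"
  shows "(norm (u - a *\<^sub>R laplacian A u))\<^sup>2 \<le> (norm u)\<^sup>2 - a * (1 - a) * disagreement A u"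
proof -
  have "(norm (u - a *\<^sub>R laplacian A u))\<^sup>2
      = (norm u)\<^sup>2 - 2 * a * (u \<bullet> laplacian A u) + a\<^sup>2 * (norm (laplacian A u))\<^sup>2"
    unfolding power2_norm_eq_inner power2_eq_square[of a]
    by (simp add: inner_diff inner_commute algebra_simps)
  also have "\<dots> \<le> (norm u)\<^sup>2 - a * disagreement A u + a\<^sup>2 * disagreement A u"
    using norm_laplacian_power2_le[OF assms(1), of u] mult_left_mono[of _ _ "a\<^sup>2"]
    by (simp add: inner_laplacian[OF assms(1), of u, symmetric])
  finally show ?thesis by (simp add: algebra_simps power2_eq_square)
qed

lemma norm_laplacian_step_le:
  fixes u :: "'a::real_inner^'v"
  assumes "doubly_stochastic A" "0 \<le> a" "a \<le> 1"
  shows "norm (u - a *\<^sub>R laplacian A u) \<le> norm u"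
proof (rule power2_le_imp_le)
  have "0 \<le> a * (1 - a) * disagreement A u"
    using assms disagreement_nonneg[OF assms(1), of u] by simp
  then show "(norm (u - a *\<^sub>R laplacian A u))\<^sup>2 \<le> (norm u)\<^sup>2"
    using norm_laplacian_step_power2_le[OF assms(1,2), of u] by linarith
qed auto

text \<open>Allows the state at a later time of a window to be traded for the state at its start:
  half of the disagreement survives, up to an error quadratic in the distance moved.\<close>

lemma disagreement_perturb:
  fixes u v :: "'a::real_normed_vector^'v"
  assumes "doubly_stochastic A"
  shows "disagreement A u \<ge> disagreement A v / 2 - disagreement A (u - v)"
proof -
  have sq: "(norm b)\<^sup>2 / 2 - (norm (a - b))\<^sup>2 \<le> (norm a)\<^sup>2" for a b :: 'a
  proof -
    have "(norm b)\<^sup>2 \<le> (norm a + norm (a - b))\<^sup>2"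
      using norm_triangle_ineq4[of a "a - b"] by (intro power_mono) auto
    also have "\<dots> \<le> 2 * (norm a)\<^sup>2 + 2 * (norm (a - b))\<^sup>2"
      using sum_squares_bound[of "norm a" "norm (a - b)"] by (simp add: power2_sum)
    finally show ?thesis by simp
  qed
  have "disagreement A v / 2 - disagreement A (u - v) =
    (\<Sum>i\<in>UNIV. \<Sum>j\<in>UNIV. A $ i $ j *
        ((norm (v $ i - v $ j))\<^sup>2 / 2 - (norm ((u $ i - u $ j) - (v $ i - v $ j)))\<^sup>2))"
    by (simp add: disagreement_def sum_divide_distrib right_diff_distrib sum_subtractf algebra_simps)
  also have "\<dots> \<le> disagreement A u"
    unfolding disagreement_def
    by (intro sum_mono mult_left_mono sq) (auto simp: doubly_stochasticD[OF assms])
  finally show ?thesis .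
qed

lemma disagreement_scaleR: "disagreement A (c *\<^sub>R u) = c\<^sup>2 * disagreement A u"
  by (simp add: disagreement_def power_mult_distrib sum_distrib_left mult.left_commute
      flip: scaleR_diff_right)

lemma continuous_on_disagreement: "continuous_on S (disagreement A)"
  unfolding disagreement_def by (intro continuous_intros)

text \<open>All summands are nonnegative, so each vanishes. Edge weights are positive, which forces
  equality along every edge, and directed paths in the union graph carry it to every pair of
  nodes.\<close>

lemma disagreement_zero_imp_eq:
  fixes G :: "'m::finite \<Rightarrow> ('v::finite) wgraph" and u :: "'a::real_normed_vector^'v"
  assumes "\<And>r. weighted_digraph (G r)" "\<And>r. doubly_stochastic (adjacency (G r))"
    and sc: "strongly_connected (union_graph G)"
    and 0: "(\<Sum>r\<in>UNIV. disagreement (adjacency (G r)) u) = 0"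
  shows "u $ i = u $ j"
proof -
  let ?U = "union_graph G"
  have D0: "disagreement (adjacency (G r)) u = 0" for r
    using 0 disagreement_nonneg[OF assms(2)] by (subst (asm) sum_nonneg_eq_0_iff) auto
  have term0: "adjacency (G r) $ i $ j * (norm (u $ i - u $ j))\<^sup>2 = 0" for r i j
  proof -
    have nn: "0 \<le> adjacency (G r) $ i $ j * (norm (u $ i - u $ j))\<^sup>2" for i j
      using doubly_stochasticD[OF assms(2)] by simp
    from D0[of r] have "(\<Sum>j\<in>UNIV. adjacency (G r) $ i $ j * (norm (u $ i - u $ j))\<^sup>2) = 0"
      unfolding disagreement_def by (subst (asm) sum_nonneg_eq_0_iff) (auto intro: sum_nonneg nn)
    then show ?thesis by (subst (asm) sum_nonneg_eq_0_iff) (auto intro: nn)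
  qed
  have edge: "u $ j = u $ i" if "(j, i) \<in> edges (G r)" for r i j
  proof -
    have "adjacency (G r) $ i $ j > 0"
      using that assms(1)[of r] unfolding weighted_digraph_def by blast
    with term0[of r i j] show ?thesis by simp
  qed
  have "i \<rightarrow>\<^sup>*\<^bsub>?U\<^esub> j"
    using sc by (auto simp: strongly_connected_def union_graph_def)
  then show ?thesis
    unfolding reachable_def
  proof (induction rule: rtrancl_on_induct)
    case (step y z)
    then show ?case using edge by (auto simp: arcs_ends_def arc_to_ends_def union_graph_def)
  qed simp
qed

text \<open>A spectral gap for the union graph, obtained by compactness: the total disagreement is
  continuous and positive on the zero-sum unit sphere, so it has a positive minimum there, and
  quadratic homogeneity extends the bound to all zero-sum vectors.\<close>

lemma disagreement_coercive:
  fixes G :: "'m::finite \<Rightarrow> ('v::finite) wgraph"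
  assumes "\<And>r. weighted_digraph (G r)" "\<And>r. doubly_stochastic (adjacency (G r))"
    and "strongly_connected (union_graph G)"
  obtains c where "c > 0"
    "\<And>u :: 'a::euclidean_space^'v. (\<Sum>i\<in>UNIV. u $ i) = 0 \<Longrightarrow>
        c * (norm u)\<^sup>2 \<le> (\<Sum>r\<in>UNIV. disagreement (adjacency (G r)) u)"
proof -
  define S where "S = (\<lambda>u :: 'a^'v. \<Sum>r\<in>UNIV. disagreement (adjacency (G r)) u)"
  define K where "K = sphere (0 :: 'a^'v) 1 \<inter> {u. (\<Sum>i\<in>UNIV. u $ i) = 0}"
  have "compact K"
    unfolding K_def by (intro compact_Int_closed compact_sphere closed_Collect_eq continuous_intros)
  have cont: "continuous_on K S"
    unfolding S_def by (intro continuous_intros continuous_on_disagreement)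
  have pos: "S u > 0" if "u \<in> K" for u
  proof (rule ccontr)
    assume "\<not> S u > 0"
    moreover have "S u \<ge> 0"
      unfolding S_def by (intro sum_nonneg disagreement_nonneg assms)
    ultimately have eq: "u $ i = u $ j" for i j
      using disagreement_zero_imp_eq[OF assms, where u = u] by (auto simp: S_def)
    have "(\<Sum>i\<in>UNIV. u $ i) = (\<Sum>i\<in>(UNIV :: 'v set). u $ j)" for j
      by (intro sum.cong refl eq)
    then have "(\<Sum>i\<in>UNIV. u $ i) = of_nat CARD('v) *\<^sub>R u $ j" for j
      by (simp add: sum_constant_scaleR)
    then have "u $ j = 0" for j
      using that by (simp add: K_def)
    then have "u = 0" by (simp add: vec_eq_iff)
    then show False using that by (simp add: K_def)
  qed
  have "\<exists>c>0. \<forall>u\<in>K. c \<le> S u"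
  proof (cases "K = {}")
    \<comment> \<open>This happens for instance with a single node, where zero is the only zero-sum
      vector.\<close>
    case True
    then show ?thesis by (auto intro: exI[of _ 1])
  next
    case False
    from continuous_attains_inf[OF \<open>compact K\<close> False cont] pos show ?thesis by blast
  qed
  then obtain c where c: "c > 0" "\<And>u. u \<in> K \<Longrightarrow> c \<le> S u" by blast
  have "c * (norm u)\<^sup>2 \<le> S u" if "(\<Sum>i\<in>UNIV. u $ i) = 0" for u
  proof (cases "u = 0")
    case True
    then show ?thesis by (simp add: S_def disagreement_def)
  next
    case False
    define v where "v = (1 / norm u) *\<^sub>R u"
    have "v \<in> K"
      using False that by (simp add: K_def v_def flip: scaleR_sum_right)
    have "u = norm u *\<^sub>R v" using False by (simp add: v_def)
    then have "S u = (norm u)\<^sup>2 * S v"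
      by (metis (no_types, lifting) S_def disagreement_scaleR sum.cong sum_distrib_left)
    then show ?thesis
      using mult_right_mono[OF c(2)[OF \<open>v \<in> K\<close>], of "(norm u)\<^sup>2"] by (simp add: mult.commute)
  qed
  then show ?thesis using that c(1) by (auto simp: S_def)
qed

text \<open>With small steps the state stays near \<open>F 0\<close> throughout the window, so the
  disagreement collected along the flow is at least a fixed fraction of the coercive bound at
  \<open>F 0\<close>. Each step converts its disagreement into a decrease of the squared
  norm.\<close>

lemma laplacian_flow_contraction:
  fixes F :: "nat \<Rightarrow> 'a::real_inner^'v"
  assumes ds: "\<And>t. doubly_stochastic (A t)"
    and F: "\<And>t. F (Suc t) = F t - a t *\<^sub>R laplacian (A t) (F t)"
    and a: "\<And>t. t < T \<Longrightarrow> lo \<le> a t" "\<And>t. t < T \<Longrightarrow> a t \<le> h" and lo: "0 \<le> lo" and h: "h \<le> 1/2"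
    and small: "64 * h\<^sup>2 * real T ^ 3 \<le> c"
    and coercive: "c * (norm (F 0))\<^sup>2 \<le> (\<Sum>t<T. disagreement (A t) (F 0))"
  shows "norm (F T) \<le> (1 - lo * c / 16) * norm (F 0)"
proof (cases "F 0 = 0")
  case True
  have "t \<le> T \<Longrightarrow> F t = 0" for t
    by (induction t) (auto simp: True F laplacian_def vec_eq_iff)
  then show ?thesis using True by simp
next
  case False
  define V where "V = (norm (F 0))\<^sup>2"
  have V: "V > 0" using False by (simp add: V_def)
  have a01: "0 \<le> a t" "a t \<le> 1/2" if "t < T" for t
    using a[OF that] lo h by auto
  have mono: "t \<le> T \<Longrightarrow> norm (F t) \<le> norm (F 0)" for t
  proof (induction t)
    case (Suc t)
    have "norm (F (Suc t)) \<le> norm (F t)"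
      unfolding F using a01[of t] Suc.prems by (intro norm_laplacian_step_le ds) auto
    then show ?case using Suc by simp
  qed simp
  have drift: "t \<le> T \<Longrightarrow> norm (F t - F 0) \<le> 2 * h * real t * norm (F 0)" for t
  proof (induction t)
    case (Suc t)
    have "norm (F (Suc t) - F 0) \<le> norm (F t - F 0) + norm (a t *\<^sub>R laplacian (A t) (F t))"
      unfolding F using norm_triangle_ineq4[of "F t - F 0" "a t *\<^sub>R laplacian (A t) (F t)"]
      by (simp add: algebra_simps)
    also have "norm (a t *\<^sub>R laplacian (A t) (F t)) \<le> h * (2 * norm (F 0))"
      using a01[of t] a(2)[of t] Suc.prems mono[of t] norm_laplacian_le[OF ds[of t], of "F t"]
      by (auto intro!: mult_mono)
    finally show ?case using Suc by (simp add: algebra_simps)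
  qed simp
  \<comment> \<open>The coercive bound, halved by the perturbation estimate, leaves
    \<open>c / 2 * V\<close>. The factor 64 keeps the total drift error, \<open>T\<close> times
    \<open>16 * h\<^sup>2 * (real T)\<^sup>2 * V\<close>, below \<open>c / 4 * V\<close>.\<close>
  have "64 * h\<^sup>2 * real T ^ 3 * V \<le> c * V"
    using small V by (intro mult_right_mono) auto
  then have "c / 4 * V \<le> (\<Sum>t<T. disagreement (A t) (F 0)) / 2 - (\<Sum>t<T. 16 * h\<^sup>2 * (real T)\<^sup>2 * V)"
    using coercive by (simp add: V_def field_simps power2_eq_square power3_eq_cube)
  also have "\<dots> = (\<Sum>t<T. disagreement (A t) (F 0) / 2 - 16 * h\<^sup>2 * (real T)\<^sup>2 * V)"
    by (simp add: sum_subtractf sum_divide_distrib)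
  also have "\<dots> \<le> (\<Sum>t<T. disagreement (A t) (F t))"
  proof (rule sum_mono)
    fix t assume t: "t \<in> {..<T}"
    have h0: "0 \<le> h" using a01[of t] a(2)[of t] t by auto
    have "norm (F t - F 0) \<le> 2 * h * real T * norm (F 0)"
      using t h0 by (intro order_trans[OF drift[of t]] mult_right_mono mult_left_mono) auto
    then have "(norm (F t - F 0))\<^sup>2 \<le> (2 * h * real T * norm (F 0))\<^sup>2"
      by (intro power_mono) auto
    then have "disagreement (A t) (F t - F 0) \<le> 16 * h\<^sup>2 * (real T)\<^sup>2 * V"
      using disagreement_le[OF ds[of t], of "F t - F 0"] by (simp add: V_def power_mult_distrib)
    then show "disagreement (A t) (F 0) / 2 - 16 * h\<^sup>2 * (real T)\<^sup>2 * V \<le> disagreement (A t) (F t)"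
      using disagreement_perturb[OF ds[of t], of "F 0" "F t"] by linarith
  qed
  finally have D: "c / 4 * V \<le> (\<Sum>t<T. disagreement (A t) (F t))" .
  have "t \<le> T \<Longrightarrow> (norm (F t))\<^sup>2 \<le> V - (\<Sum>s<t. lo / 2 * disagreement (A s) (F s))" for t
  proof (induction t)
    case (Suc t)
    have "lo * (1/2) \<le> a t * (1 - a t)"
      using a01[of t] a(1)[of t] Suc.prems lo by (intro mult_mono) auto
    then have "lo / 2 * disagreement (A t) (F t) \<le> a t * (1 - a t) * disagreement (A t) (F t)"
      using disagreement_nonneg[OF ds[of t]] by (intro mult_right_mono) auto
    moreover have "(norm (F (Suc t)))\<^sup>2 \<le> (norm (F t))\<^sup>2 - a t * (1 - a t) * disagreement (A t) (F t)"
      unfolding F using a01[of t] Suc.prems by (intro norm_laplacian_step_power2_le ds) auto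
    ultimately show ?case using Suc by simp
  qed (simp add: V_def)
  from this[of T] have "(norm (F T))\<^sup>2 \<le> V - lo / 2 * (\<Sum>t<T. disagreement (A t) (F t))"
    by (simp add: sum_distrib_left)
  also have "\<dots> \<le> V - lo / 2 * (c / 4 * V)"
    using D lo by (intro diff_left_mono mult_left_mono) auto
  also have "\<dots> = (1 - lo * c / 8) * V" by (simp add: field_simps)
  finally have *: "(norm (F T))\<^sup>2 \<le> (1 - lo * c / 8) * V" .
  \<comment> \<open>A square is bounded by this product, so the factor cannot be negative. This
    supplies the sign of \<open>1 - lo * c / 16\<close> needed to take square roots.\<close>
  then have "0 \<le> (1 - lo * c / 8) * V"
    using zero_le_power2 order_trans by blast
  then have le1: "lo * c / 8 \<le> 1" using V by (simp add: zero_le_mult_iff)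
  show ?thesis
  proof (rule power2_le_imp_le)
    have "1 - lo * c / 8 \<le> (1 - lo * c / 16)\<^sup>2"
      using zero_le_power2[of "lo * c / 16"] by (simp add: power2_diff mult.commute)
    then have "(1 - lo * c / 8) * V \<le> (1 - lo * c / 16)\<^sup>2 * V"
      using V by (intro mult_right_mono) auto
    then show "(norm (F T))\<^sup>2 \<le> ((1 - lo * c / 16) * norm (F 0))\<^sup>2"
      using * by (simp add: V_def power_mult_distrib)
  qed (use le1 in auto)
qed

text \<open>The noiseless flow \<open>F\<close> from the same starting point contracts. The step is
  linear and nonexpansive, so the distance of \<open>E\<close> from \<open>F\<close> grows by at
  most the noise at each time.\<close>

lemma noisy_laplacian_flow_contraction:
  fixes E w :: "nat \<Rightarrow> 'a::real_inner^'v"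
  assumes ds: "\<And>t. doubly_stochastic (A t)"
    and E: "\<And>t. E (Suc t) = E t - a t *\<^sub>R laplacian (A t) (E t) - w t"
    and w: "\<And>t. t < T \<Longrightarrow> norm (w t) \<le> b"
    and a: "\<And>t. t < T \<Longrightarrow> lo \<le> a t" "\<And>t. t < T \<Longrightarrow> a t \<le> h" and lo: "0 \<le> lo" and h: "h \<le> 1/2"
    and small: "64 * h\<^sup>2 * real T ^ 3 \<le> c"
    and coercive: "c * (norm (E 0))\<^sup>2 \<le> (\<Sum>t<T. disagreement (A t) (E 0))"
  shows "norm (E T) \<le> (1 - lo * c / 16) * norm (E 0) + real T * b"
proof -
  define F where "F = rec_nat (E 0) (\<lambda>t u. u - a t *\<^sub>R laplacian (A t) u)"
  have F: "F 0 = E 0" "\<And>t. F (Suc t) = F t - a t *\<^sub>R laplacian (A t) (F t)"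
    by (simp_all add: F_def)
  have "t \<le> T \<Longrightarrow> norm (E t - F t) \<le> real t * b" for t
  proof (induction t)
    case (Suc t)
    let ?D = "E t - F t"
    have "norm (E (Suc t) - F (Suc t)) = norm ((?D - a t *\<^sub>R laplacian (A t) ?D) - w t)"
      by (simp add: E F laplacian_diff algebra_simps)
    also have "\<dots> \<le> norm (?D - a t *\<^sub>R laplacian (A t) ?D) + norm (w t)"
      by (rule norm_triangle_ineq4)
    also have "norm (?D - a t *\<^sub>R laplacian (A t) ?D) \<le> norm ?D"
      using a[of t] lo h Suc.prems by (intro norm_laplacian_step_le ds) auto
    finally show ?case using Suc w[of t] by (simp add: algebra_simps)
  qed (simp add: F)
  from this[of T] have "norm (E T) \<le> norm (F T) + real T * b"
    using norm_triangle_ineq2[of "E T" "F T"] by simp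
  also have "norm (F T) \<le> (1 - lo * c / 16) * norm (F 0)"
    using assms F by (intro laplacian_flow_contraction[where A = A and a = a and h = h]) auto
  finally show ?thesis by (simp add: F)
qed

subsection \<open>Real sequences\<close>

text \<open>Since \<rho> decreases, \<open>\<rho> n * w n\<close> loses
  \<open>c * (\<rho> n * a n * w n)\<close> and gains at most \<open>\<rho> n * e n\<close> in each
  step, and the losses telescope.\<close>

lemma summable_weighted_contraction:
  fixes w a \<rho> e :: "nat \<Rightarrow> real"
  assumes w: "\<And>n. 0 \<le> w n" and a: "\<And>n. 0 \<le> a n" and \<rho>: "\<And>n. 0 \<le> \<rho> n" "decseq \<rho>" and c: "0 < c"
    and step: "\<And>n. w (Suc n) \<le> (1 - c * a n) * w n + e n"
    and e: "\<And>n. 0 \<le> e n" "summable (\<lambda>n. \<rho> n * e n)"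
  shows "summable (\<lambda>n. \<rho> n * a n * w n)"
proof (rule bounded_imp_summable)
  show "0 \<le> \<rho> n * a n * w n" for n using w a \<rho> by simp
  have tele: "c * (\<Sum>k<n. \<rho> k * a k * w k) + \<rho> n * w n \<le> \<rho> 0 * w 0 + (\<Sum>k<n. \<rho> k * e k)" for n
  proof (induction n)
    case (Suc n)
    have "\<rho> (Suc n) * w (Suc n) \<le> \<rho> n * w (Suc n)"
      using \<rho>(2) w by (intro mult_right_mono) (auto simp: decseq_Suc_iff)
    also have "\<dots> \<le> \<rho> n * ((1 - c * a n) * w n + e n)"
      by (intro mult_left_mono step \<rho>)
    also have "\<dots> = \<rho> n * w n - c * (\<rho> n * a n * w n) + \<rho> n * e n"
      by (simp add: algebra_simps)
    finally have "\<rho> (Suc n) * w (Suc n) \<le> \<rho> n * w n - c * (\<rho> n * a n * w n) + \<rho> n * e n" .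
    then show ?case using Suc by (simp add: algebra_simps)
  qed simp
  show "(\<Sum>k\<le>n. \<rho> k * a k * w k) \<le> (\<rho> 0 * w 0 + suminf (\<lambda>k. \<rho> k * e k)) / c" for n
  proof -
    have "(\<Sum>k<Suc n. \<rho> k * e k) \<le> suminf (\<lambda>k. \<rho> k * e k)"
      using e \<rho> by (intro sum_le_suminf) auto
    moreover have "0 \<le> \<rho> (Suc n) * w (Suc n)" using w \<rho> by simp
    ultimately have "c * (\<Sum>k<Suc n. \<rho> k * a k * w k) \<le> \<rho> 0 * w 0 + suminf (\<lambda>k. \<rho> k * e k)"
      using tele[of "Suc n"] by linarith
    then show ?thesis using c by (simp add: field_simps lessThan_Suc_atMost)
  qed
qed

text \<open>The square of \<open>v\<close> increases by at most the summable amount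
  \<open>g\<close>, so subtracting the partial sums of \<open>g\<close> leaves a decreasing sequence
  bounded below, and \<open>v\<close> converges. A positive limit would dominate \<open>b\<close> by
  a multiple of the summable \<open>b t * v t\<close>.\<close>

lemma tendsto_0_of_summable_weights:
  fixes v b :: "nat \<Rightarrow> real"
  assumes v: "\<And>t. 0 \<le> v t" and b: "\<And>t. 0 \<le> b t"
    and step: "\<And>t. v (Suc t) \<le> v t + C * b t" and C: "0 \<le> C"
    and bv: "summable (\<lambda>t. b t * v t)" and bb: "summable (\<lambda>t. (b t)\<^sup>2)" and div: "\<not> summable b"
  shows "v \<longlonglongrightarrow> 0"
proof -
  define g where "g t = 2 * C * (b t * v t) + C\<^sup>2 * (b t)\<^sup>2" for t
  have g: "summable g" unfolding g_def by (intro summable_add summable_mult bv bb)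
  define s where "s t = (v t)\<^sup>2 - (\<Sum>k<t. g k)" for t
  have g0: "0 \<le> g t" for t using v b C by (simp add: g_def)
  have "(v (Suc t))\<^sup>2 \<le> (v t)\<^sup>2 + g t" for t
  proof -
    have "(v (Suc t))\<^sup>2 \<le> (v t + C * b t)\<^sup>2" using v step by (intro power_mono) auto
    then show ?thesis by (simp add: g_def power2_sum power_mult_distrib algebra_simps)
  qed
  then have "decseq s" by (simp add: s_def decseq_Suc_iff algebra_simps)
  moreover have "- suminf g \<le> s t" for t
  proof -
    have "(\<Sum>k<t. g k) \<le> suminf g" using g g0 by (intro sum_le_suminf) auto
    then show ?thesis using zero_le_power2[of "v t"] unfolding s_def by linarith
  qed
  ultimately obtain L where L: "s \<longlonglongrightarrow> L" by (metis decseq_convergent)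
  have "(\<lambda>t. s t + (\<Sum>k<t. g k)) \<longlonglongrightarrow> L + suminf g"
    using L summable_LIMSEQ[OF g] by (rule tendsto_add)
  then have "(\<lambda>t. sqrt ((v t)\<^sup>2)) \<longlonglongrightarrow> sqrt (L + suminf g)"
    unfolding s_def by (intro tendsto_real_sqrt) simp
  then have lim: "v \<longlonglongrightarrow> sqrt (L + suminf g)" (is "_ \<longlonglongrightarrow> ?l") using v by simp
  have "?l \<ge> 0" using lim v by (intro LIMSEQ_le_const) auto
  moreover have "\<not> ?l > 0"
  proof
    assume l: "?l > 0"
    then have "\<forall>\<^sub>F t in sequentially. ?l / 2 < v t"
      by (intro order_tendstoD(1)[OF lim]) simp
    then have "\<forall>\<^sub>F t in sequentially. norm (b t) \<le> 2 / ?l * (b t * v t)"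
    proof eventually_elim
      case (elim t)
      then have "b t * (?l / 2) \<le> b t * v t" using b by (intro mult_left_mono) auto
      then show ?case using l b by (simp add: field_simps)
    qed
    then have "summable b" by (rule summable_comparison_test_ev) (intro summable_mult bv)
    with div show False by simp
  qed
  ultimately show ?thesis using lim by simp
qed

subsection \<open>Covering windows of an irreducible Markov chain\<close>

text \<open>Induction on the set still to be visited: go to the new state \<open>a\<close>, then
  follow a walk from \<open>a\<close> through the remaining states. Walks are infinite so that all
  of them can later be cut at a common length.\<close>

lemma covering_walk:
  fixes R :: "'m::finite \<Rightarrow> 'm \<Rightarrow> bool"
  assumes serial: "\<And>r. \<exists>s. R r s" and conn: "\<And>r s. R\<^sup>*\<^sup>* r s"
  shows "\<exists>w :: nat \<Rightarrow> 'm. w 0 = r \<and> (\<forall>t. R (w t) (w (Suc t))) \<and> range w = UNIV"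
proof -
  define walk where "walk S r w \<longleftrightarrow> w 0 = r \<and> (\<forall>t. R (w t) (w (Suc t))) \<and> S \<subseteq> range w"
    for S r and w :: "nat \<Rightarrow> 'm"
  have "\<exists>w. walk S r w" if "finite S" for S r using that
  proof (induction S arbitrary: r rule: finite_induct)
    case empty
    obtain nxt where "\<And>r. R r (nxt r)" using serial by metis
    then have "walk {} r (\<lambda>t. (nxt ^^ t) r)" by (simp add: walk_def)
    then show ?case by blast
  next
    case (insert a S)
    \<comment> \<open>Inner induction along a path from \<open>r\<close> to \<open>a\<close>,
      prepending one state at a time to the walk that starts at \<open>a\<close>.\<close>
    from conn[of r a] show ?case
    proof (induction rule: converse_rtranclp_induct)
      case base
      from insert.IH[of a] obtain w where "walk S a w" by blast
      then have "walk (insert a S) a w" by (auto simp: walk_def)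
      then show ?case by blast
    next
      case (step r r')
      then obtain w where w: "walk (insert a S) r' w" by blast
      have "walk (insert a S) r (case_nat r w)"
        unfolding walk_def
      proof (intro conjI allI subsetI)
        show "R (case_nat r w t) (case_nat r w (Suc t))" for t
          using w step(1) by (cases t) (auto simp: walk_def)
        show "z \<in> range (case_nat r w)" if z: "z \<in> insert a S" for z
        proof -
          from w z obtain t where "z = w t" by (auto simp: walk_def)
          then have "z = case_nat r w (Suc t)" by simp
          then show ?thesis by blast
        qed
      qed simp
      then show ?case by blast
    qed
  qed
  from this[of UNIV r] show ?thesis by (auto simp: walk_def)
qed

text \<open>A positive entry of a matrix power is a sum with some positive term, and nonnegativity
  of \<open>P\<close> makes the first factor of that term a positive transition. Power zero gives
  the empty path.\<close>

lemma irreducible_matrix_rtranclp: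
  assumes irr: "irreducible_matrix P" and nonneg: "\<And>r s. 0 \<le> P $ r $ s"
  shows "(\<lambda>r s. P $ r $ s > 0)\<^sup>*\<^sup>* r s"
proof -
  have "matrix_power P t $ r $ s > 0 \<Longrightarrow> (\<lambda>r s. P $ r $ s > 0)\<^sup>*\<^sup>* r s" for t r
  proof (induction t arbitrary: r)
    case 0
    then show ?case by (simp add: matrix_power_def mat_def split: if_splits)
  next
    case (Suc t)
    have "(\<Sum>q\<in>UNIV. P $ r $ q * matrix_power P t $ q $ s) > 0"
      using Suc.prems by (simp add: matrix_power_def matrix_matrix_mult_def)
    then obtain q where q: "P $ r $ q * matrix_power P t $ q $ s > 0"
      by (meson leD not_le_imp_less sum_nonpos)
    then have "P $ r $ q > 0" "matrix_power P t $ q $ s > 0"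
      using nonneg[of r q] by (auto simp: zero_less_mult_iff)
    then show ?case using Suc.IH[of q] by (meson converse_rtranclp_into_rtranclp)
  qed
  then show ?thesis using irr unfolding irreducible_matrix_def by blast
qed

text \<open>Iterates the one-step transition law. A history of probability zero is outside the scope
  of that law, but its extensions then have probability zero too.\<close>

lemma markov_chain_path_prob:
  assumes "prob_space M" "markov_chain M \<theta> P"
  shows "\<P>(\<omega> in M. \<forall>t\<le>k + j. \<theta> t \<omega> = s t)
      = \<P>(\<omega> in M. \<forall>t\<le>k. \<theta> t \<omega> = s t) * (\<Prod>i<j. P $ s (k + i) $ s (Suc (k + i)))"
proof (induction j)
  case (Suc j)
  interpret prob_space M by fact
  have meas[measurable]: "\<theta> t \<in> M \<rightarrow>\<^sub>M count_space UNIV" for t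
    using assms(2) by (simp add: markov_chain_def)
  let ?H = "\<lambda>k \<omega>. \<forall>t\<le>k. \<theta> t \<omega> = s t"
  have eq: "?H (Suc n) \<omega> \<longleftrightarrow> \<theta> (Suc n) \<omega> = s (Suc n) \<and> ?H n \<omega>" for n \<omega>
    by (auto simp: le_Suc_eq)
  have step: "\<P>(\<omega> in M. ?H (Suc n) \<omega>) = \<P>(\<omega> in M. ?H n \<omega>) * P $ s n $ s (Suc n)" for n
  proof (cases "\<P>(\<omega> in M. ?H n \<omega>) > 0")
    case True
    then have "\<P>(\<omega> in M. \<theta> (Suc n) \<omega> = s (Suc n) \<bar> ?H n \<omega>) = P $ s n $ s (Suc n)"
      using assms(2) by (simp add: markov_chain_def)
    with True show ?thesis by (simp add: cond_prob_def eq field_simps)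
  next
    case False
    then have 0: "\<P>(\<omega> in M. ?H n \<omega>) = 0" by (simp add: zero_less_measure_iff)
    have "\<P>(\<omega> in M. ?H (Suc n) \<omega>) \<le> \<P>(\<omega> in M. ?H n \<omega>)"
      by (intro finite_measure_mono) auto
    then show ?thesis using 0 by (simp add: measure_le_0_iff)
  qed
  show ?case using Suc step[of "k + j"] by simp
qed simp

lemma sets_range_covering:
  fixes \<theta> :: "nat \<Rightarrow> 'w \<Rightarrow> 'm::finite"
  assumes meas[measurable]: "\<And>t. \<theta> t \<in> M \<rightarrow>\<^sub>M count_space UNIV"
  shows "{\<omega> \<in> space M. (\<lambda>t. \<theta> (k + t) \<omega>) ` {..<T} = UNIV} \<in> sets M"
proof -
  have *: "(\<lambda>t. \<theta> (k + t) \<omega>) ` {..<T} = UNIV \<longleftrightarrow> (\<forall>r. \<exists>t\<in>{..<T}. \<theta> (k + t) \<omega> = r)" for \<omega>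
    by (auto simp: set_eq_iff image_iff) metis+
  show ?thesis unfolding * by measurable
qed

text \<open>After any history the chain may follow a fixed covering walk from its current state.
  There are finitely many states, so one length \<open>T\<close> serves all these walks, and their
  transition products have a positive minimum \<open>p\<close>.\<close>

lemma markov_chain_covering_windows:
  assumes P: "prob_space M" and mc: "markov_chain M \<theta> P" and irr: "irreducible_matrix P"
  obtains T p where "0 < T" "0 < p" "\<And>k s. \<P>(\<omega> in M. (\<forall>t\<le>k. \<theta> t \<omega> = s t) \<and> (\<lambda>t. \<theta> (k + t) \<omega>) ` {..<T} = UNIV)
      \<ge> p * \<P>(\<omega> in M. \<forall>t\<le>k. \<theta> t \<omega> = s t)"
proof -
  interpret prob_space M by fact
  have meas[measurable]: "\<theta> t \<in> M \<rightarrow>\<^sub>M count_space UNIV" for t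
    using mc by (simp add: markov_chain_def)
  have nonneg: "0 \<le> P $ r $ s" and rows: "(\<Sum>s\<in>UNIV. P $ r $ s) = 1" for r s
    using mc by (auto simp: markov_chain_def row_stochastic_def)
  have "\<exists>s. P $ r $ s > 0" for r
  proof (rule ccontr)
    assume "\<nexists>s. P $ r $ s > 0"
    then have "(\<Sum>s\<in>UNIV. P $ r $ s) \<le> 0" by (intro sum_nonpos) (auto simp: not_less)
    then show False using rows[of r] by simp
  qed
  from covering_walk[OF this irreducible_matrix_rtranclp[OF irr nonneg]]
  obtain w where w: "\<And>r. w r 0 = r" "\<And>r t. P $ w r t $ w r (Suc t) > 0" "\<And>r. range (w r) = UNIV"
    by metis
  have "\<exists>T. w r ` {..<T} = UNIV" for r
  proof -
    have "UNIV \<subseteq> range (w r)" using w(3)[of r] by simp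
    then obtain N where N: "finite N" "UNIV = w r ` N"
      by (metis finite_subset_image finite subset_UNIV top_le)
    from finite_nat_set_iff_bounded[of N] N(1) obtain T where "N \<subseteq> {..<T}" by auto
    then show ?thesis using N by blast
  qed
  then obtain \<tau> where \<tau>: "\<And>r. w r ` {..<\<tau> r} = UNIV" by metis
  define T where "T = Suc (Max (range \<tau>))"
  have T: "w r ` {..<T} = UNIV" for r
  proof -
    have "\<tau> r \<le> Max (range \<tau>)" by (intro Max_ge) auto
    then have "\<tau> r \<le> T" unfolding T_def by (rule le_SucI)
    then have "w r ` {..<\<tau> r} \<subseteq> w r ` {..<T}" by (intro image_mono) simp
    then show ?thesis unfolding \<tau>[of r] by (rule top_le)
  qed
  define q where "q r = (\<Prod>i<T. P $ w r i $ w r (Suc i))" for r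
  define p where "p = Min (range q)"
  have "0 < q r" for r unfolding q_def by (intro prod_pos) (auto simp: w)
  then have "0 < p" by (simp add: p_def)
  have pq: "p \<le> q r" for r by (simp add: p_def)
  have "p * \<P>(\<omega> in M. \<forall>t\<le>k. \<theta> t \<omega> = s t)
      \<le> \<P>(\<omega> in M. (\<forall>t\<le>k. \<theta> t \<omega> = s t) \<and> (\<lambda>t. \<theta> (k + t) \<omega>) ` {..<T} = UNIV)" for k s
  proof -
    \<comment> \<open>The history \<open>s\<close> continued by the walk of its last state; both
      descriptions agree at time \<open>k\<close> because \<open>w r 0 = r\<close>.\<close>
    define s' where "s' t = (if t \<le> k then s t else w (s k) (t - k))" for t
    have s': "s' (k + i) = w (s k) i" for i using w(1) by (cases i) (auto simp: s'_def)
    have "p * \<P>(\<omega> in M. \<forall>t\<le>k. \<theta> t \<omega> = s t) \<le> \<P>(\<omega> in M. \<forall>t\<le>k. \<theta> t \<omega> = s t) * q (s k)"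
      by (subst mult.commute) (intro mult_left_mono pq measure_nonneg)
    also have "\<dots> = \<P>(\<omega> in M. \<forall>t\<le>k. \<theta> t \<omega> = s' t) * (\<Prod>i<T. P $ s' (k + i) $ s' (Suc (k + i)))"
    proof -
      have "(\<Prod>i<T. P $ s' (k + i) $ s' (Suc (k + i))) = q (s k)"
        unfolding q_def by (intro prod.cong refl) (metis s' add_Suc_right)
      then show ?thesis by (simp add: s'_def)
    qed
    also have "\<dots> = \<P>(\<omega> in M. \<forall>t\<le>k + T. \<theta> t \<omega> = s' t)"
      by (rule markov_chain_path_prob[OF P mc, symmetric])
    also have "\<dots> \<le> \<P>(\<omega> in M. (\<forall>t\<le>k. \<theta> t \<omega> = s t) \<and> (\<lambda>t. \<theta> (k + t) \<omega>) ` {..<T} = UNIV)"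
    proof (intro finite_measure_mono subsetI)
      fix \<omega> assume "\<omega> \<in> {\<omega> \<in> space M. \<forall>t\<le>k + T. \<theta> t \<omega> = s' t}"
      then have \<omega>: "\<omega> \<in> space M" "\<And>t. t \<le> k + T \<Longrightarrow> \<theta> t \<omega> = s' t" by auto
      have "(\<lambda>t. \<theta> (k + t) \<omega>) ` {..<T} = w (s k) ` {..<T}"
        using \<omega>(2) s' by (intro image_cong) auto
      then show "\<omega> \<in> {\<omega> \<in> space M. (\<forall>t\<le>k. \<theta> t \<omega> = s t) \<and> (\<lambda>t. \<theta> (k + t) \<omega>) ` {..<T} = UNIV}"
        using \<omega> T by (auto simp: s'_def)
    next
      show "{\<omega> \<in> space M. (\<forall>t\<le>k. \<theta> t \<omega> = s t) \<and> (\<lambda>t. \<theta> (k + t) \<omega>) ` {..<T} = UNIV} \<in> events"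
        using sets_range_covering[OF meas, measurable] by measurable
    qed
    finally show ?thesis .
  qed
  then show ?thesis using that[of T p] \<open>0 < p\<close> by (simp add: T_def)
qed

text \<open>A functional of the history up to time \<open>k\<close> is a finite linear combination of
  indicators of histories, so no conditional expectation is needed.\<close>

lemma history_functional_expectation:
  fixes \<theta> :: "nat \<Rightarrow> 'w \<Rightarrow> 'm::finite" and g :: "(nat \<Rightarrow> 'm) \<Rightarrow> real"
  assumes "prob_space M" and meas: "\<And>t. \<theta> t \<in> M \<rightarrow>\<^sub>M count_space UNIV"
    and g: "\<And>s s'. (\<And>t. t \<le> k \<Longrightarrow> s t = s' t) \<Longrightarrow> g s = g s'"
    and B: "{\<omega> \<in> space M. Q \<omega>} \<in> sets M"
  shows "integrable M (\<lambda>\<omega>. g (\<lambda>t. \<theta> t \<omega>) * of_bool (Q \<omega>))" (is ?int)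
    and "(\<integral>\<omega>. g (\<lambda>t. \<theta> t \<omega>) * of_bool (Q \<omega>) \<partial>M) =
      (\<Sum>s\<in>PiE {..k} (\<lambda>_. UNIV). g s * \<P>(\<omega> in M. (\<forall>t\<le>k. \<theta> t \<omega> = s t) \<and> Q \<omega>))" (is ?eq)
proof -
  interpret prob_space M by fact
  note meas[measurable] B[measurable]
  let ?S = "PiE {..k} (\<lambda>_. UNIV :: 'm set)"
  let ?A = "\<lambda>s. {\<omega> \<in> space M. (\<forall>t\<le>k. \<theta> t \<omega> = s t) \<and> Q \<omega>}"
  have fin: "finite ?S" by (intro finite_PiE) auto
  have ev: "?A s \<in> events" for s by measurable
  have dec: "g (\<lambda>t. \<theta> t \<omega>) * of_bool (Q \<omega>) = (\<Sum>s\<in>?S. g s * indicator (?A s) \<omega>)"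
    if \<omega>: "\<omega> \<in> space M" for \<omega>
  proof -
    \<comment> \<open>Among the members of \<open>?S\<close>, only \<open>h\<close> is realised at
      \<omega>, so the sum collapses to one term. The default values of \<open>h\<close> beyond time
      \<open>k\<close> are invisible to \<open>g\<close>.\<close>
    define h where "h = restrict (\<lambda>t. \<theta> t \<omega>) {..k}"
    have h: "h \<in> ?S" by (simp add: h_def)
    have uniq: "s = h" if "s \<in> ?S" "\<And>t. t \<le> k \<Longrightarrow> \<theta> t \<omega> = s t" for s
      using that by (intro PiE_ext[of s _ _ h]) (auto simp: h_def)
    have "(\<Sum>s\<in>?S. g s * indicator (?A s) \<omega>) = (\<Sum>s\<in>{h}. g s * indicator (?A s) \<omega>)"
      using fin h uniq by (intro sum.mono_neutral_right) (auto simp: indicator_def)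
    also have "\<dots> = g h * of_bool (\<omega> \<in> ?A h)"
      by (simp only: sum.insert finite.emptyI empty_iff simp_thms sum.empty add_0_right indicator_def)
    also have "\<omega> \<in> ?A h \<longleftrightarrow> Q \<omega>"
      using \<omega> by (auto simp: h_def)
    also have "g h = g (\<lambda>t. \<theta> t \<omega>)" by (intro g) (simp add: h_def)
    finally show ?thesis by simp
  qed
  have int: "integrable M (\<lambda>\<omega>. g s * indicator (?A s) \<omega>)" for s
    using ev by (intro integrable_mult_right) (auto simp: integrable_indicator_iff emeasure_eq_measure)
  show ?int
    by (subst Bochner_Integration.integrable_cong[OF refl dec]) (auto intro!: Bochner_Integration.integrable_sum int)
  have "(\<integral>\<omega>. g (\<lambda>t. \<theta> t \<omega>) * of_bool (Q \<omega>) \<partial>M) = (\<integral>\<omega>. (\<Sum>s\<in>?S. g s * indicator (?A s) \<omega>) \<partial>M)"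
    by (intro Bochner_Integration.integral_cong refl dec)
  also have "\<dots> = (\<Sum>s\<in>?S. g s * prob (?A s))"
  proof -
    have "(\<integral>\<omega>. g s * indicator (?A s) \<omega> \<partial>M) = g s * prob (?A s)" for s
      using sets.sets_into_space[OF ev[of s]] by (simp add: Int_absorb2)
    then show ?thesis by (subst Bochner_Integration.integral_sum[OF int]) simp
  qed
  finally show ?eq .
qed

text \<open>By Tonelli the expectation of the series is the finite series of expectations, so the
  series is finite almost everywhere.\<close>

lemma AE_summable_of_summable_integral:
  fixes Z :: "nat \<Rightarrow> 'w \<Rightarrow> real"
  assumes int: "\<And>n. integrable M (Z n)" and nonneg: "\<And>n \<omega>. 0 \<le> Z n \<omega>"
    and sum: "summable (\<lambda>n. \<integral>\<omega>. Z n \<omega> \<partial>M)"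
  shows "AE \<omega> in M. summable (\<lambda>n. Z n \<omega>)"
proof -
  have [measurable]: "Z n \<in> borel_measurable M" for n using int by auto
  have "(\<integral>\<^sup>+\<omega>. (\<Sum>n. ennreal (Z n \<omega>)) \<partial>M) = (\<Sum>n. \<integral>\<^sup>+\<omega>. ennreal (Z n \<omega>) \<partial>M)"
    by (intro nn_integral_suminf) auto
  also have "\<dots> = (\<Sum>n. ennreal (\<integral>\<omega>. Z n \<omega> \<partial>M))"
    by (intro suminf_cong nn_integral_eq_integral int) (auto simp: nonneg)
  also have "\<dots> = ennreal (\<Sum>n. \<integral>\<omega>. Z n \<omega> \<partial>M)"
    using sum nonneg by (intro suminf_ennreal2) auto
  finally have "(\<integral>\<^sup>+\<omega>. (\<Sum>n. ennreal (Z n \<omega>)) \<partial>M) \<noteq> \<infinity>" by simp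
  then have "AE \<omega> in M. (\<Sum>n. ennreal (Z n \<omega>)) \<noteq> \<infinity>"
    by (intro nn_integral_PInf_AE) auto
  then show ?thesis
    by eventually_elim (rule summable_suminf_not_top, auto simp: nonneg)
qed

lemma summable_of_blocks:
  fixes f :: "nat \<Rightarrow> real"
  assumes f: "\<And>t. 0 \<le> f t" and T: "0 < T"
    and blocks: "summable (\<lambda>n. \<Sum>t\<in>{n * T..<n * T + T}. f t)"
  shows "summable f"
proof (rule bounded_imp_summable)
  fix n
  let ?g = "\<lambda>n. \<Sum>t\<in>{n * T..<n * T + T}. f t"
  have "n < Suc n * T" using T by (cases T) auto
  then have "(\<Sum>t\<le>n. f t) \<le> (\<Sum>t<Suc n * T. f t)"
    by (intro sum_mono2) (auto simp: f)
  also have "\<dots> = (\<Sum>k<Suc n. ?g k)" by (simp only: sum.nat_group)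
  also have "\<dots> \<le> suminf ?g" by (intro sum_le_suminf blocks) (auto intro: sum_nonneg f)
  finally show "(\<Sum>t\<le>n. f t) \<le> suminf ?g" .
qed (rule f)

text \<open>Within a block \<open>v\<close> exceeds its starting value by at most \<open>T\<close>
  noise terms and \<open>b\<close> decreases, so the block sum of \<open>b t * v t\<close> is at
  most \<open>T\<close> times its first term plus a multiple of a summable square.\<close>

lemma subsampled_weights_suffice:
  fixes v b :: "nat \<Rightarrow> real"
  assumes v: "\<And>t. 0 \<le> v t" and b: "\<And>t. 0 \<le> b t" "decseq b" and C: "0 \<le> C" and T: "0 < T"
    and step: "\<And>t. K \<le> t \<Longrightarrow> v (Suc t) \<le> v t + C * b t" and K: "K \<le> n0 * T"
    and bb: "summable (\<lambda>t. (b t)\<^sup>2)" and div: "\<not> summable b"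
    and sub: "summable (\<lambda>n. b ((n0 + n) * T) * v ((n0 + n) * T))"
  shows "summable (\<lambda>t. b t * v t)" and "v \<longlonglongrightarrow> 0"
proof -
  have drift: "v (k + j) \<le> v k + real j * (C * b k)" if "K \<le> k" for k j
  proof (induction j)
    case (Suc j)
    have "v (Suc (k + j)) \<le> v (k + j) + C * b (k + j)" using that by (intro step) auto
    also have "C * b (k + j) \<le> C * b k" using C b(2) by (intro mult_left_mono) (auto simp: decseq_def)
    finally show ?case using Suc by (simp add: algebra_simps)
  qed simp
  let ?k = "\<lambda>n. (n0 + n) * T"
  let ?g = "\<lambda>n. \<Sum>t\<in>{n * T..<n * T + T}. b t * v t"
  have le: "?g (n + n0) \<le> real T * (b (?k n) * v (?k n)) + (real T)\<^sup>2 * C * (b n)\<^sup>2" for n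
  proof -
    have Kk: "K \<le> ?k n" using K by (simp add: distrib_right trans_le_add1)
    have nk: "n \<le> ?k n" using T by (cases T) auto
    have "?g (n + n0) \<le> (\<Sum>t\<in>{(n + n0) * T..<(n + n0) * T + T}. b (?k n) * (v (?k n) + real T * (C * b (?k n))))"
    proof (rule sum_mono)
      fix t assume t: "t \<in> {(n + n0) * T..<(n + n0) * T + T}"
      define j where "j = t - ?k n"
      have j: "t = ?k n + j" "j < T" using t by (auto simp: j_def add.commute)
      have "v t \<le> v (?k n) + real j * (C * b (?k n))" unfolding j(1) by (rule drift[OF Kk])
      also have "\<dots> \<le> v (?k n) + real T * (C * b (?k n))"
        using j(2) C b by (intro add_left_mono mult_right_mono) auto
      finally show "b t * v t \<le> b (?k n) * (v (?k n) + real T * (C * b (?k n)))"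
        using b v j(1) by (intro mult_mono) (auto simp: decseq_def)
    qed
    also have "\<dots> = real T * (b (?k n) * v (?k n)) + (real T)\<^sup>2 * C * (b (?k n))\<^sup>2"
      by (simp add: algebra_simps power2_eq_square)
    also have "(b (?k n))\<^sup>2 \<le> (b n)\<^sup>2" using b nk by (intro power_mono) (auto simp: decseq_def)
    finally show ?thesis using C by (simp add: mult_left_mono)
  qed
  have "summable (\<lambda>n. ?g (n + n0))"
  proof (rule summable_comparison_test')
    show "summable (\<lambda>n. real T * (b (?k n) * v (?k n)) + (real T)\<^sup>2 * C * (b n)\<^sup>2)"
      by (intro summable_add summable_mult sub bb)
    show "norm (?g (n + n0)) \<le> real T * (b (?k n) * v (?k n)) + (real T)\<^sup>2 * C * (b n)\<^sup>2" if "0 \<le> n" for n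
    proof -
      have "0 \<le> ?g (n + n0)" by (intro sum_nonneg mult_nonneg_nonneg v b)
      with le[of n] show ?thesis by simp
    qed
  qed
  then have "summable ?g" by (rule summable_iff_shift[of ?g n0, THEN iffD1])
  then show *: "summable (\<lambda>t. b t * v t)"
    by (rule summable_of_blocks[rotated 2]) (simp_all add: v b T)
  have "(\<lambda>t. v (t + K)) \<longlonglongrightarrow> 0"
  proof (rule tendsto_0_of_summable_weights[where b = "\<lambda>t. b (t + K)"])
    show "summable (\<lambda>t. b (t + K) * v (t + K))" using * by (simp add: summable_iff_shift[of "\<lambda>t. b t * v t"])
    show "summable (\<lambda>t. (b (t + K))\<^sup>2)" using bb by (simp add: summable_iff_shift[of "\<lambda>t. (b t)\<^sup>2"])
    show "\<not> summable (\<lambda>t. b (t + K))" using div by (simp add: summable_iff_shift)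
  qed (use v b C step in auto)
  then show "v \<longlonglongrightarrow> 0" by (rule LIMSEQ_offset)
qed

text \<open>The sequence \<open>v\<close> may depend on the whole trajectory of the chain, since the subgradient
  selection may anticipate it.  It is therefore compared with the scalar recursion \<open>\<zeta>\<close>,
  which at time \<open>n\<close> is a function of the past of the chain only.\<close>

lemma markov_covering_contraction_summable:
  fixes \<theta> :: "nat \<Rightarrow> 'w \<Rightarrow> 'm::finite" and v :: "nat \<Rightarrow> 'w \<Rightarrow> real"
  assumes P: "prob_space M" and meas: "\<And>t. \<theta> t \<in> M \<rightarrow>\<^sub>M count_space UNIV"
    and cov: "\<And>k s. p * \<P>(\<omega> in M. \<forall>t\<le>k. \<theta> t \<omega> = s t)
        \<le> \<P>(\<omega> in M. (\<forall>t\<le>k. \<theta> t \<omega> = s t) \<and> (\<lambda>t. \<theta> (k + t) \<omega>) ` {..<T} = UNIV)"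
    and p: "0 < p"
    and \<kappa>: "\<And>n. \<kappa> (Suc n) = \<kappa> n + T"
    and a: "\<And>n. 0 \<le> a n" "\<And>n. a n \<le> 1" and \<rho>: "\<And>n. 0 \<le> \<rho> n" "decseq \<rho>"
    and e: "\<And>n. 0 \<le> e n" "summable (\<lambda>n. \<rho> n * e n)"
    and v: "\<And>n \<omega>. 0 \<le> v n \<omega>" "\<And>\<omega>. \<omega> \<in> space M \<Longrightarrow> v 0 \<omega> \<le> B"
    and step: "\<And>n \<omega>. \<omega> \<in> space M \<Longrightarrow>
      v (Suc n) \<omega> \<le> (1 - of_bool ((\<lambda>t. \<theta> (\<kappa> n + t) \<omega>) ` {..<T} = UNIV) * a n) * v n \<omega> + e n"
  shows "AE \<omega> in M. summable (\<lambda>n. \<rho> n * a n * v n \<omega>)"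
proof -
  interpret prob_space M by fact
  \<comment> \<open>Starting at \<open>max B 0\<close> makes \<zeta> nonnegative and at least
    \<open>v\<close> at index 0. The argument \<open>s\<close> is a trajectory, which makes the
    dependence on the past expressible.\<close>
  define \<zeta> where "\<zeta> = rec_nat (\<lambda>s :: nat \<Rightarrow> 'm. max B 0)
    (\<lambda>n z s. (1 - of_bool ((\<lambda>t. s (\<kappa> n + t)) ` {..<T} = UNIV) * a n) * z s + e n)"
  have \<zeta>: "\<zeta> 0 s = max B 0"
    "\<zeta> (Suc n) s = (1 - of_bool ((\<lambda>t. s (\<kappa> n + t)) ` {..<T} = UNIV) * a n) * \<zeta> n s + e n" for n s
    by (simp_all add: \<zeta>_def)
  have \<zeta>_nonneg: "0 \<le> \<zeta> n s" for n s
    by (induction n) (use a e in \<open>auto simp: \<zeta>\<close>)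
  have \<zeta>_past: "(\<And>t. t \<le> \<kappa> n \<Longrightarrow> s t = s' t) \<Longrightarrow> \<zeta> n s = \<zeta> n s'" for n s s'
  proof (induction n)
    case (Suc n)
    \<comment> \<open>Window \<open>n\<close> inspects only times before
      \<open>\<kappa> n + T\<close>, that is, before \<open>\<kappa> (Suc n)\<close>.\<close>
    have "(\<lambda>t. s (\<kappa> n + t)) ` {..<T} = (\<lambda>t. s' (\<kappa> n + t)) ` {..<T}"
      by (intro image_cong refl Suc.prems) (auto simp: \<kappa>)
    moreover have "\<zeta> n s = \<zeta> n s'" by (intro Suc.IH Suc.prems) (auto simp: \<kappa>)
    ultimately show ?case by (simp add: \<zeta>)
  qed (simp add: \<zeta>)
  define Q where "Q n \<omega> \<longleftrightarrow> (\<lambda>t. \<theta> (\<kappa> n + t) \<omega>) ` {..<T} = UNIV" for n \<omega>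
  define Z where "Z n \<omega> = \<zeta> n (\<lambda>t. \<theta> t \<omega>)" for n \<omega>
  have Z_Suc: "Z (Suc n) \<omega> = Z n \<omega> - a n * (Z n \<omega> * of_bool (Q n \<omega>)) + e n" for n \<omega>
    by (simp add: Z_def Q_def \<zeta> algebra_simps)
  have vZ: "v n \<omega> \<le> Z n \<omega>" if \<omega>: "\<omega> \<in> space M" for n \<omega>
  proof (induction n)
    case 0
    then show ?case using v(2)[OF \<omega>] by (simp add: Z_def \<zeta>)
  next
    case (Suc n)
    have "v (Suc n) \<omega> \<le> (1 - of_bool (Q n \<omega>) * a n) * v n \<omega> + e n"
      using step[OF \<omega>] by (simp add: Q_def)
    also have "\<dots> \<le> (1 - of_bool (Q n \<omega>) * a n) * Z n \<omega> + e n"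
      using Suc a by (intro add_right_mono mult_left_mono) auto
    finally show ?case by (simp add: Z_Suc algebra_simps)
  qed
  have Q: "{\<omega> \<in> space M. Q n \<omega>} \<in> events" for n
    unfolding Q_def by (rule sets_range_covering[OF meas])
  have Z_int: "integrable M (Z n)" for n
    using history_functional_expectation(1)[OF P meas, where k = "\<kappa> n" and g = "\<zeta> n" and Q = "\<lambda>_. True", OF \<zeta>_past]
    by (simp add: Z_def[abs_def])
  have ZQ_int: "integrable M (\<lambda>\<omega>. Z n \<omega> * of_bool (Q n \<omega>))" for n
    using history_functional_expectation(1)[OF P meas, where k = "\<kappa> n" and g = "\<zeta> n", OF \<zeta>_past Q] by (simp add: Z_def)
  \<comment> \<open>The covering bound holds for each single history; weighting it with the
    nonnegative values of \<zeta> and summing over histories gives the bound for the mean.\<close>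
  have cover_mean: "p * (\<integral>\<omega>. Z n \<omega> \<partial>M) \<le> (\<integral>\<omega>. Z n \<omega> * of_bool (Q n \<omega>) \<partial>M)" for n
  proof -
    let ?S = "PiE {..\<kappa> n} (\<lambda>_. UNIV :: 'm set)"
    have "(\<integral>\<omega>. Z n \<omega> \<partial>M) = (\<Sum>s\<in>?S. \<zeta> n s * \<P>(\<omega> in M. \<forall>t\<le>\<kappa> n. \<theta> t \<omega> = s t))"
      using history_functional_expectation(2)[OF P meas, where k = "\<kappa> n" and g = "\<zeta> n" and Q = "\<lambda>_. True", OF \<zeta>_past]
      by (simp add: Z_def)
    then have "p * (\<integral>\<omega>. Z n \<omega> \<partial>M) = (\<Sum>s\<in>?S. \<zeta> n s * (p * \<P>(\<omega> in M. \<forall>t\<le>\<kappa> n. \<theta> t \<omega> = s t)))"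
      by (simp add: sum_distrib_left mult.left_commute)
    also have "\<dots> \<le> (\<Sum>s\<in>?S. \<zeta> n s * \<P>(\<omega> in M. (\<forall>t\<le>\<kappa> n. \<theta> t \<omega> = s t) \<and> Q n \<omega>))"
      unfolding Q_def by (intro sum_mono mult_left_mono cov \<zeta>_nonneg)
    also have "\<dots> = (\<integral>\<omega>. Z n \<omega> * of_bool (Q n \<omega>) \<partial>M)"
      using history_functional_expectation(2)[OF P meas, where k = "\<kappa> n" and g = "\<zeta> n", OF \<zeta>_past Q] by (simp add: Z_def)
    finally show ?thesis .
  qed
  define W where "W n = (\<integral>\<omega>. Z n \<omega> \<partial>M)" for n
  have "W (Suc n) \<le> (1 - p * a n) * W n + e n" for n
  proof -
    have "W (Suc n) = W n - a n * (\<integral>\<omega>. Z n \<omega> * of_bool (Q n \<omega>) \<partial>M) + e n"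
      unfolding W_def Z_Suc using Z_int ZQ_int by (simp add: prob_space)
    also have "\<dots> \<le> W n - a n * (p * W n) + e n"
      using cover_mean[of n] a by (simp add: W_def mult_left_mono)
    finally show ?thesis by (simp add: algebra_simps)
  qed
  moreover have "0 \<le> W n" for n
    unfolding W_def Z_def by (intro Bochner_Integration.integral_nonneg \<zeta>_nonneg)
  ultimately have "summable (\<lambda>n. \<rho> n * a n * W n)"
    using a e \<rho> p by (intro summable_weighted_contraction[where e = e and c = p])
  then have "summable (\<lambda>n. \<integral>\<omega>. \<rho> n * a n * Z n \<omega> \<partial>M)" by (simp add: W_def)
  moreover have "0 \<le> \<rho> n * a n * Z n \<omega>" for n \<omega>
    using a \<rho> \<zeta>_nonneg by (simp add: Z_def)
  ultimately have "AE \<omega> in M. summable (\<lambda>n. \<rho> n * a n * Z n \<omega>)"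
    using Z_int by (intro AE_summable_of_summable_integral) auto
  moreover have "AE \<omega> in M. \<omega> \<in> space M" by (rule AE_space)
  ultimately show ?thesis
  proof eventually_elim
    case (elim \<omega>)
    have "norm (\<rho> n * a n * v n \<omega>) \<le> \<rho> n * a n * Z n \<omega>" for n
      using elim(2) v(1) a \<rho> vZ by (simp add: mult_left_mono)
    then show ?case by (intro summable_comparison_test'[OF elim(1)])
  qed
qed

lemma summable_powr_Suc_iff: "summable (\<lambda>k. (real k + 1) powr s) \<longleftrightarrow> s < -1"
  using summable_Suc_iff[of "\<lambda>k. real k powr s"] by (simp add: summable_real_powr_iff add.commute)

subsection \<open>Consensus\<close>

lemma norm_vec_le_card:
  fixes u :: "'a::real_normed_vector^'v"
  assumes "\<And>i. norm (u $ i) \<le> C"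
  shows "norm u \<le> real CARD('v) * C"
proof -
  have "norm u \<le> (\<Sum>i\<in>UNIV. norm (u $ i))"
    unfolding norm_vec_def by (intro L2_set_le_sum) auto
  also have "\<dots> \<le> real CARD('v) * C"
    using sum_bounded_above[of UNIV "\<lambda>i. norm (u $ i)" C] assms by simp
  finally show ?thesis .
qed

text \<open>Each state is visited at least once, and repeated visits only add nonnegative
  terms.\<close>

lemma covering_sum_ge:
  fixes g :: "'m \<Rightarrow> real" and h :: "nat \<Rightarrow> 'm"
  assumes "\<And>r. 0 \<le> g r" "h ` {..<T} = UNIV"
  shows "(\<Sum>r\<in>UNIV. g r) \<le> (\<Sum>t<T. g (h t))"
  using sum_image_le[OF finite_lessThan, of T g h] assms by (simp add: comp_def)

theorem theorem1:
  fixes f :: "'v::finite \<Rightarrow> real^'n \<Rightarrow> real"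
    and l a1 a2 \<delta>1 \<delta>2 :: real
    and G :: "'m::finite \<Rightarrow> 'v wgraph"
    and P :: "real^'m^'m"
    and M :: "'w measure"
    and \<theta> :: "nat \<Rightarrow> 'w \<Rightarrow> 'm"
    and \<alpha> \<beta> :: "nat \<Rightarrow> real"
    and x0 :: "'v \<Rightarrow> real^'n"
    and x d :: "'v \<Rightarrow> nat \<Rightarrow> 'w \<Rightarrow> real^'n"
    and y :: "nat \<Rightarrow> 'w \<Rightarrow> real^'n"
  assumes "prob_space M"
    and "\<And>i. lower_semicontinuous (f i)"
    and "\<And>i. convex_on UNIV (f i)"
    and A1_minimizer: "{z. is_arg_min (\<lambda>u. \<Sum>i\<in>UNIV. f i u) (\<lambda>_. True) z} \<noteq> {}"
    and A1_bound: "\<And>i z g. g \<in> subdifferential (f i) z \<Longrightarrow> norm g \<le> l"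
    and A2_graphs: "\<And>r. weighted_digraph (G r)"
    and A2_doubly: "\<And>r. doubly_stochastic (adjacency (G r))"
    and A2_union: "strongly_connected (union_graph G)"
    and A2_chain: "markov_chain M \<theta> P"
    and A2_irreducible: "irreducible_matrix P"
    and A3_alpha: "\<alpha> = (\<lambda>k. a1 / (real k + 1) powr \<delta>1)"
    and A3_beta: "\<beta> = (\<lambda>k. a2 / (real k + 1) powr \<delta>2)"
    and A3_consts: "a1 > 0" "a2 > 0" "0 < \<delta>1" "\<delta>1 < \<delta>2" "\<delta>2 \<le> 1" "\<delta>2 - \<delta>1 \<ge> 1/2"
    and x_measurable: "\<And>i k. x i k \<in> borel_measurable M"
    and d_measurable: "\<And>i k. d i k \<in> borel_measurable M"
    and initial: "\<And>i \<omega>. \<omega> \<in> space M \<Longrightarrow> x i 0 \<omega> = x0 i"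
    and subgradient: "\<And>i k \<omega>. \<omega> \<in> space M \<Longrightarrow> d i k \<omega> \<in> subdifferential (f i) (x i k \<omega>)"
    and recursion: "\<And>i k \<omega>. \<omega> \<in> space M \<Longrightarrow>
      x i (Suc k) \<omega> = x i k \<omega>
        + \<alpha> k *\<^sub>R (\<Sum>j\<in>UNIV. adjacency (G (\<theta> k \<omega>)) $ i $ j *\<^sub>R (x j k \<omega> - x i k \<omega>))
        - \<beta> k *\<^sub>R d i k \<omega>"
    and average: "y = (\<lambda>k \<omega>. (1 / real CARD('v)) *\<^sub>R (\<Sum>i\<in>UNIV. x i k \<omega>))"
  shows "(\<forall>i. AE \<omega> in M. (\<lambda>k. norm (x i k \<omega> - y k \<omega>)) \<longlonglongrightarrow> 0) \<and>
         (\<forall>i. AE \<omega> in M. summable (\<lambda>k. \<beta> (Suc k) * norm (y (Suc k) \<omega> - x i (Suc k) \<omega>)))"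
proof -
  interpret prob_space M by fact

  \<comment> \<open>Disagreement vector and centred subgradients\<close>
  define N where "N = real CARD('v)"
  have N: "N > 0" by (simp add: N_def)
  define A where "A t \<omega> = adjacency (G (\<theta> t \<omega>))" for t \<omega>
  define E :: "nat \<Rightarrow> 'w \<Rightarrow> (real^'n)^'v" where "E t \<omega> = (\<chi> i. x i t \<omega> - y t \<omega>)" for t \<omega>
  define dm where "dm t \<omega> = (1 / N) *\<^sub>R (\<Sum>i\<in>UNIV. d i t \<omega>)" for t \<omega>
  define D :: "nat \<Rightarrow> 'w \<Rightarrow> (real^'n)^'v" where "D t \<omega> = (\<chi> i. d i t \<omega> - dm t \<omega>)" for t \<omega>
  define C where "C = N * (2 * l)"
  have ds: "doubly_stochastic (A t \<omega>)" for t \<omega> by (simp add: A_def A2_doubly)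
  have meas: "\<theta> t \<in> M \<rightarrow>\<^sub>M count_space UNIV" for t using A2_chain by (simp add: markov_chain_def)

  have d_le: "norm (d i t \<omega>) \<le> l" if "\<omega> \<in> space M" for i t \<omega>
    using A1_bound subgradient that by blast
  \<comment> \<open>A probability space has a point, so some subgradient is realised and its norm
    forces \<open>l\<close> to be nonnegative.\<close>
  obtain \<omega>0 where "\<omega>0 \<in> space M" using not_empty by blast
  from d_le[OF this, of undefined 0] have l: "0 \<le> l" using norm_ge_zero order_trans by blast
  have C: "0 \<le> C" using l N by (simp add: C_def)
  have D_le: "norm (D t \<omega>) \<le> C" if \<omega>: "\<omega> \<in> space M" for t \<omega>
  proof -
    have "norm (dm t \<omega>) \<le> (1 / N) * (\<Sum>i\<in>(UNIV :: 'v set). norm (d i t \<omega>))"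
      unfolding dm_def using N by (simp add: divide_right_mono norm_sum)
    also have "\<dots> \<le> (1 / N) * (N * l)"
      using sum_bounded_above[of UNIV "\<lambda>i. norm (d i t \<omega>)" l] d_le[OF \<omega>] N
      by (intro mult_left_mono) (auto simp: N_def)
    finally have "norm (dm t \<omega>) \<le> l" using N by simp
    then have "norm (D t \<omega> $ i) \<le> 2 * l" for i
      using norm_triangle_ineq4[of "d i t \<omega>" "dm t \<omega>"] d_le[OF \<omega>, of i t] by (simp add: D_def)
    then show ?thesis unfolding C_def N_def by (rule norm_vec_le_card)
  qed

  \<comment> \<open>Dynamics of the disagreement vector\<close>
  have y_N: "N *\<^sub>R y t \<omega> = (\<Sum>i\<in>UNIV. x i t \<omega>)" for t \<omega>
    using N by (simp add: average N_def)
  have E_sum: "(\<Sum>i\<in>UNIV. E t \<omega> $ i) = 0" for t \<omega>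
    by (simp only: E_def vec_lambda_beta sum_subtractf sum_constant_scaleR N_def[symmetric] y_N diff_self)
  have E_step: "E (Suc t) \<omega> = E t \<omega> - \<alpha> t *\<^sub>R laplacian (A t \<omega>) (E t \<omega>) - \<beta> t *\<^sub>R D t \<omega>"
    if \<omega>: "\<omega> \<in> space M" for t \<omega>
  proof -
    let ?L = "\<lambda>i. \<Sum>j\<in>UNIV. A t \<omega> $ i $ j *\<^sub>R (x j t \<omega> - x i t \<omega>)"
    have "(\<Sum>i\<in>UNIV. ?L i) = 0"
      by (simp add: sum_laplacian_eq_0[OF ds])
    then have "(\<Sum>i\<in>UNIV. x i (Suc t) \<omega>) = (\<Sum>i\<in>UNIV. x i t \<omega>) - \<beta> t *\<^sub>R (\<Sum>i\<in>UNIV. d i t \<omega>)"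
      using \<omega> by (simp add: recursion A_def[symmetric] sum.distrib sum_subtractf flip: scaleR_sum_right)
    then have y_step: "y (Suc t) \<omega> = y t \<omega> - \<beta> t *\<^sub>R dm t \<omega>"
      by (simp add: average dm_def N_def scaleR_diff_right)
    have "E (Suc t) \<omega> $ i = (E t \<omega> - \<alpha> t *\<^sub>R laplacian (A t \<omega>) (E t \<omega>) - \<beta> t *\<^sub>R D t \<omega>) $ i" for i
    proof -
      \<comment> \<open>Subtracting the average does not affect differences of states, and the
        recursion uses the opposite sign.\<close>
      have "laplacian (A t \<omega>) (E t \<omega>) $ i = - ?L i"
        by (simp add: laplacian_def E_def flip: sum_negf scaleR_minus_right)
      then show ?thesis
        using \<omega> by (simp add: E_def D_def recursion A_def[symmetric] y_step scaleR_diff_right)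
    qed
    then show ?thesis by (simp add: vec_eq_iff)
  qed

  \<comment> \<open>Estimates for the step sizes\<close>
  have \<alpha>_eq: "\<alpha> t = a1 * (real t + 1) powr - \<delta>1" and \<beta>_eq: "\<beta> t = a2 * (real t + 1) powr - \<delta>2" for t
    by (simp_all add: A3_alpha A3_beta powr_minus_divide)
  have powr_antimono: "(real t + 1) powr - s \<le> (real t' + 1) powr - s" if "t' \<le> t" "0 < s" for t t' s
    using that by (intro powr_mono2') auto
  have \<alpha>_pos: "0 < \<alpha> t" and \<beta>_pos: "0 < \<beta> t" for t
    using A3_consts by (simp_all add: \<alpha>_eq \<beta>_eq)
  have \<alpha>_mono: "\<alpha> t \<le> \<alpha> t'" and \<beta>_mono: "\<beta> t \<le> \<beta> t'" if "t' \<le> t" for t t'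
    using A3_consts that powr_antimono by (simp_all add: \<alpha>_eq \<beta>_eq)
  have \<alpha>_lim: "\<alpha> \<longlonglongrightarrow> 0"
    unfolding A3_alpha using A3_consts(3) by real_asymp
  have \<beta>_sq: "summable (\<lambda>t. (\<beta> t)\<^sup>2)"
  proof -
    have "(\<beta> t)\<^sup>2 = a2\<^sup>2 * (real t + 1) powr (- 2 * \<delta>2)" for t
      by (simp add: \<beta>_eq power_mult_distrib powr_power)
    \<comment> \<open>Here \<delta>2 > 1/2, since \<delta>1 is positive and the exponents differ by
      at least 1/2.\<close>
    moreover have "summable (\<lambda>t. (real t + 1) powr (- 2 * \<delta>2))"
      using A3_consts by (subst summable_powr_Suc_iff) auto
    ultimately show ?thesis by (simp add: summable_mult)
  qed
  have \<beta>_div: "\<not> summable \<beta>"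
  proof
    assume "summable \<beta>"
    then have "summable (\<lambda>t. a2 * (real t + 1) powr - \<delta>2)" by (simp add: \<beta>_eq[abs_def])
    then have "summable (\<lambda>t. (real t + 1) powr - \<delta>2)"
      using A3_consts(2) by (simp add: summable_cmult_iff)
    then show False using A3_consts by (simp add: summable_powr_Suc_iff)
  qed

  \<comment> \<open>Coercivity constant, window length and starting time\<close>
  obtain c where c: "c > 0" "\<And>u :: (real^'n)^'v. (\<Sum>i\<in>UNIV. u $ i) = 0 \<Longrightarrow>
        c * (norm u)\<^sup>2 \<le> (\<Sum>r\<in>UNIV. disagreement (adjacency (G r)) u)"
    using disagreement_coercive[OF A2_graphs A2_doubly A2_union] by blast
  obtain T p where T: "0 < T" and p: "0 < p" and
    cov: "\<And>k s. p * \<P>(\<omega> in M. \<forall>t\<le>k. \<theta> t \<omega> = s t)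
        \<le> \<P>(\<omega> in M. (\<forall>t\<le>k. \<theta> t \<omega> = s t) \<and> (\<lambda>t. \<theta> (k + t) \<omega>) ` {..<T} = UNIV)"
    using markov_chain_covering_windows[OF \<open>prob_space M\<close> A2_chain A2_irreducible] by blast
  have lims: "(\<lambda>t. 64 * (\<alpha> t)\<^sup>2 * real T ^ 3) \<longlonglongrightarrow> 64 * 0\<^sup>2 * real T ^ 3"
    "(\<lambda>t. \<alpha> t * c / 16) \<longlonglongrightarrow> 0 * c / 16"
    by (intro tendsto_intros \<alpha>_lim; simp)+
  \<comment> \<open>In turn: small drift within a window, a contraction factor that stays
    nonnegative, and steps short enough to be nonexpansive.\<close>
  have "\<forall>\<^sub>F t in sequentially. 64 * (\<alpha> t)\<^sup>2 * real T ^ 3 < c"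
    "\<forall>\<^sub>F t in sequentially. \<alpha> t * c / 16 < 1"
    "\<forall>\<^sub>F t in sequentially. \<alpha> t < 1 / 2"
    by (rule order_tendstoD(2)[OF lims(1)] order_tendstoD(2)[OF lims(2)] order_tendstoD(2)[OF \<alpha>_lim]; simp add: c(1))+
  then have "\<forall>\<^sub>F t in sequentially. 64 * (\<alpha> t)\<^sup>2 * real T ^ 3 < c \<and> \<alpha> t * c / 16 < 1 \<and> \<alpha> t < 1 / 2"
    by (intro eventually_conj)
  then obtain K where K: "\<And>t. K \<le> t \<Longrightarrow> 64 * (\<alpha> t)\<^sup>2 * real T ^ 3 < c"
    "\<And>t. K \<le> t \<Longrightarrow> \<alpha> t * c / 16 < 1" "\<And>t. K \<le> t \<Longrightarrow> \<alpha> t < 1 / 2"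
    unfolding eventually_sequentially by blast
  \<comment> \<open>The offset \<open>Suc K\<close> puts all windows after time \<open>K\<close> and
    ensures \<open>T \<le> \<kappa> n\<close>, which keeps the noise weights at both ends of a
    window comparable.\<close>
  define \<kappa> where "\<kappa> n = (Suc K + n) * T" for n
  have \<kappa>_Suc: "\<kappa> (Suc n) = \<kappa> n + T" for n by (simp add: \<kappa>_def)
  have \<kappa>_ge: "K + n \<le> \<kappa> n" and T_le: "T \<le> \<kappa> n" for n
    using T by (cases T; simp add: \<kappa>_def)+
  have \<kappa>_mono: "\<kappa> m \<le> \<kappa> n" if "m \<le> n" for m n using that by (simp add: \<kappa>_def)

  \<comment> \<open>One step and one window of the disagreement vector\<close>
  have step1: "norm (E (Suc t) \<omega>) \<le> norm (E t \<omega>) + C * \<beta> t" if "K \<le> t" "\<omega> \<in> space M" for t \<omega>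
  proof -
    have "norm (E (Suc t) \<omega>) \<le> norm (E t \<omega> - \<alpha> t *\<^sub>R laplacian (A t \<omega>) (E t \<omega>)) + norm (\<beta> t *\<^sub>R D t \<omega>)"
      unfolding E_step[OF that(2)] by (rule norm_triangle_ineq4)
    also have "norm (E t \<omega> - \<alpha> t *\<^sub>R laplacian (A t \<omega>) (E t \<omega>)) \<le> norm (E t \<omega>)"
      using K(3)[OF that(1)] \<alpha>_pos[of t] by (intro norm_laplacian_step_le ds) auto
    also have "norm (\<beta> t *\<^sub>R D t \<omega>) \<le> C * \<beta> t"
      using D_le[OF that(2), of t] \<beta>_pos[of t] by (simp add: mult.commute)
    finally show ?thesis by simp
  qed
  have drift: "norm (E (\<kappa> n + j) \<omega>) \<le> norm (E (\<kappa> n) \<omega>) + real j * (C * \<beta> (\<kappa> n))"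
    if "\<omega> \<in> space M" for n j \<omega>
  proof (induction j)
    case (Suc j)
    have "norm (E (Suc (\<kappa> n + j)) \<omega>) \<le> norm (E (\<kappa> n + j) \<omega>) + C * \<beta> (\<kappa> n + j)"
      using \<kappa>_ge[of n] that by (intro step1) auto
    moreover have "C * \<beta> (\<kappa> n + j) \<le> C * \<beta> (\<kappa> n)" using C \<beta>_mono by (intro mult_left_mono) auto
    ultimately show ?case using Suc by (simp add: algebra_simps)
  qed simp

  \<comment> \<open>The step sizes of window \<open>n\<close> are bounded below by their value at
    its end, the noise weights above by their value at its start. Up to a constant \<rho> is the
    ratio of \<beta> to \<alpha> at the window end, so \<open>\<rho> n * a n\<close> is a multiple
    of \<open>\<beta> (\<kappa> (Suc n))\<close>.\<close>
  define a where "a n = \<alpha> (\<kappa> (Suc n)) * c / 16" for n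
  define e where "e n = real T * (C * \<beta> (\<kappa> n))" for n
  define \<rho> where "\<rho> n = (real (\<kappa> (Suc n)) + 1) powr - (\<delta>2 - \<delta>1)" for n
  have window: "norm (E (\<kappa> (Suc n)) \<omega>)
      \<le> (1 - of_bool ((\<lambda>t. \<theta> (\<kappa> n + t) \<omega>) ` {..<T} = UNIV) * a n) * norm (E (\<kappa> n) \<omega>) + e n"
    if \<omega>: "\<omega> \<in> space M" for n \<omega>
  proof (cases "(\<lambda>t. \<theta> (\<kappa> n + t) \<omega>) ` {..<T} = UNIV")
    case True
    have "norm (E (\<kappa> n + T) \<omega>) \<le> (1 - \<alpha> (\<kappa> (Suc n)) * c / 16) * norm (E (\<kappa> n + 0) \<omega>) + real T * (C * \<beta> (\<kappa> n))"
    proof (rule noisy_laplacian_flow_contraction[where E = "\<lambda>t. E (\<kappa> n + t) \<omega>" and A = "\<lambda>t. A (\<kappa> n + t) \<omega>"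
          and a = "\<lambda>t. \<alpha> (\<kappa> n + t)" and w = "\<lambda>t. \<beta> (\<kappa> n + t) *\<^sub>R D (\<kappa> n + t) \<omega>" and h = "\<alpha> (\<kappa> n)"])
      show "E (\<kappa> n + Suc t) \<omega> = E (\<kappa> n + t) \<omega> - \<alpha> (\<kappa> n + t) *\<^sub>R laplacian (A (\<kappa> n + t) \<omega>) (E (\<kappa> n + t) \<omega>)
          - \<beta> (\<kappa> n + t) *\<^sub>R D (\<kappa> n + t) \<omega>" for t
        using E_step[OF \<omega>, of "\<kappa> n + t"] by simp
      show "norm (\<beta> (\<kappa> n + t) *\<^sub>R D (\<kappa> n + t) \<omega>) \<le> C * \<beta> (\<kappa> n)" for t
      proof -
        have "\<beta> (\<kappa> n + t) * norm (D (\<kappa> n + t) \<omega>) \<le> \<beta> (\<kappa> n) * C"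
          using \<beta>_mono[of "\<kappa> n" "\<kappa> n + t"] D_le[OF \<omega>] \<beta>_pos[of "\<kappa> n"] by (intro mult_mono) auto
        then show ?thesis using \<beta>_pos[of "\<kappa> n + t"] by (simp add: mult.commute)
      qed
      show "\<alpha> (\<kappa> (Suc n)) \<le> \<alpha> (\<kappa> n + t)" if "t < T" for t
        using that by (intro \<alpha>_mono) (simp add: \<kappa>_Suc)
      have "c * (norm (E (\<kappa> n) \<omega>))\<^sup>2 \<le> (\<Sum>r\<in>UNIV. disagreement (adjacency (G r)) (E (\<kappa> n) \<omega>))"
        by (intro c E_sum)
      also have "\<dots> \<le> (\<Sum>t<T. disagreement (A (\<kappa> n + t) \<omega>) (E (\<kappa> n) \<omega>))"
        unfolding A_def using True by (intro covering_sum_ge disagreement_nonneg A2_doubly)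
      finally show "c * (norm (E (\<kappa> n + 0) \<omega>))\<^sup>2 \<le> (\<Sum>t<T. disagreement (A (\<kappa> n + t) \<omega>) (E (\<kappa> n + 0) \<omega>))"
        by simp
    qed (use ds \<alpha>_mono \<alpha>_pos K[of "\<kappa> n"] \<kappa>_ge[of n] in \<open>auto intro: less_imp_le\<close>)
    then show ?thesis using True by (simp add: \<kappa>_Suc a_def e_def)
  next
    case False
    then show ?thesis using drift[OF \<omega>, of n T] by (simp add: \<kappa>_Suc e_def)
  qed

  \<comment> \<open>Deterministic bound at the first window\<close>
  have "\<exists>B. \<forall>\<omega>\<in>space M. norm (E t \<omega>) \<le> B" for t
  proof (induction t)
    case 0
    have "norm (E 0 \<omega>) = norm (E 0 \<omega>0)" if "\<omega> \<in> space M" for \<omega>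
      using that \<open>\<omega>0 \<in> space M\<close> by (simp add: E_def average initial)
    then show ?case by (metis order_refl)
  next
    case (Suc t)
    then obtain B where B: "\<And>\<omega>. \<omega> \<in> space M \<Longrightarrow> norm (E t \<omega>) \<le> B" by blast
    \<comment> \<open>Before time \<open>K\<close> a step may be expansive, so only the operator
      bound 2 for the Laplacian is used. Growth with \<open>t\<close> is harmless, because only the
      fixed time \<open>\<kappa> 0\<close> matters.\<close>
    have "norm (E (Suc t) \<omega>) \<le> B + \<alpha> t * (2 * B) + \<beta> t * C" if \<omega>: "\<omega> \<in> space M" for \<omega>
    proof -
      have "norm (E (Suc t) \<omega>) \<le> norm (E t \<omega>) + norm (\<alpha> t *\<^sub>R laplacian (A t \<omega>) (E t \<omega>)) + norm (\<beta> t *\<^sub>R D t \<omega>)"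
        unfolding E_step[OF \<omega>] by (intro norm_triangle_le_diff add_right_mono norm_triangle_ineq4)
      also have "\<dots> \<le> B + \<alpha> t * (2 * B) + \<beta> t * C"
        using B[OF \<omega>] D_le[OF \<omega>, of t] norm_laplacian_le[OF ds[of t \<omega>], of "E t \<omega>"] \<alpha>_pos[of t] \<beta>_pos[of t]
        by (intro add_mono) (auto intro!: mult_left_mono)
      finally show ?thesis .
    qed
    then show ?case by blast
  qed
  then obtain B where B: "\<And>\<omega>. \<omega> \<in> space M \<Longrightarrow> norm (E (\<kappa> 0) \<omega>) \<le> B" by blast

  \<comment> \<open>Almost sure summability over the window starts\<close>
  have \<rho>e: "summable (\<lambda>n. \<rho> n * e n)"
  proof (rule summable_comparison_test')
    \<comment> \<open>The exponent \<open>2 * \<delta>2 - \<delta>1\<close> is the sum of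
      \<open>\<delta>2 - \<delta>1\<close>, at least 1/2, and \<delta>2, which exceeds 1/2.\<close>
    show "summable (\<lambda>n. real T * C * a2 * (real n + 1) powr - (2 * \<delta>2 - \<delta>1))"
      using A3_consts by (intro summable_mult) (subst summable_powr_Suc_iff, auto)
    show "norm (\<rho> n * e n) \<le> real T * C * a2 * (real n + 1) powr - (2 * \<delta>2 - \<delta>1)" if "0 \<le> n" for n
    proof -
      have "\<rho> n \<le> (real n + 1) powr - (\<delta>2 - \<delta>1)"
        unfolding \<rho>_def using A3_consts \<kappa>_ge[of "Suc n"] by (intro powr_antimono) auto
      moreover have "\<beta> (\<kappa> n) \<le> a2 * (real n + 1) powr - \<delta>2"
        unfolding \<beta>_eq using A3_consts \<kappa>_ge[of n] by (intro mult_left_mono powr_antimono) auto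
      ultimately have "\<rho> n * \<beta> (\<kappa> n) \<le> (real n + 1) powr - (\<delta>2 - \<delta>1) * (a2 * (real n + 1) powr - \<delta>2)"
        using \<beta>_pos[of "\<kappa> n"] by (intro mult_mono) auto
      also have "\<dots> = a2 * (real n + 1) powr - (2 * \<delta>2 - \<delta>1)"
        by (simp add: powr_add[symmetric] algebra_simps)
      finally have "real T * C * (\<rho> n * \<beta> (\<kappa> n)) \<le> real T * C * (a2 * (real n + 1) powr - (2 * \<delta>2 - \<delta>1))"
        using C by (intro mult_left_mono) auto
      moreover have "0 \<le> \<rho> n * e n" using C \<beta>_pos[of "\<kappa> n"] by (simp add: \<rho>_def e_def)
      ultimately show ?thesis by (simp add: e_def mult_ac)
    qed
  qed
  have "AE \<omega> in M. summable (\<lambda>n. \<rho> n * a n * norm (E (\<kappa> n) \<omega>))"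
  proof (rule markov_covering_contraction_summable[OF \<open>prob_space M\<close> meas cov p, where \<kappa> = \<kappa> and B = B and e = e])
    show "decseq \<rho>"
      unfolding \<rho>_def decseq_def using A3_consts
      by (intro allI impI powr_antimono \<kappa>_mono) auto
    show "a n \<le> 1" for n
      using K(2)[of "\<kappa> (Suc n)"] \<kappa>_ge[of "Suc n"] by (simp add: a_def)
    show "0 \<le> a n" "0 \<le> e n" for n
      using c(1) C \<alpha>_pos[of "\<kappa> (Suc n)"] \<beta>_pos[of "\<kappa> n"] by (simp_all add: a_def e_def)
  qed (use \<kappa>_Suc \<rho>e B window in \<open>auto simp: \<rho>_def\<close>)
  moreover have "AE \<omega> in M. \<omega> \<in> space M" by (rule AE_space)

  \<comment> \<open>From the window starts to all times\<close>
  ultimately have main: "AE \<omega> in M. summable (\<lambda>t. \<beta> t * norm (E t \<omega>)) \<and> (\<lambda>t. norm (E t \<omega>)) \<longlonglongrightarrow> 0"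
  proof eventually_elim
    case (elim \<omega>)
    \<comment> \<open>The factor \<open>16 * a2 / (a1 * c)\<close> turns
      \<open>\<rho> n * a n\<close> into \<open>\<beta> (\<kappa> (Suc n))\<close>. The extra 2
      moves back to the start of the window: \<open>\<kappa> (Suc n) + 1\<close> is at most twice
      \<open>\<kappa> n + 1\<close>, and \<open>2 powr \<delta>2\<close> is at most 2.\<close>
    define q where "q = 2 * (16 * a2 / (a1 * c))"
    have q: "\<beta> (\<kappa> n) \<le> q * (\<rho> n * a n)" for n
    proof -
      have "\<rho> n * a n = c / 16 * a1 * (real (\<kappa> (Suc n)) + 1) powr (- (\<delta>2 - \<delta>1) + - \<delta>1)"
        unfolding \<rho>_def a_def \<alpha>_eq powr_add by (simp add: mult_ac)
      then have qa: "q * (\<rho> n * a n) = 2 * a2 * (real (\<kappa> (Suc n)) + 1) powr - \<delta>2"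
        using A3_consts c(1) by (simp add: q_def field_simps)
      have "(real (\<kappa> n) + 1) powr - \<delta>2 = 2 powr \<delta>2 * (2 * (real (\<kappa> n) + 1)) powr - \<delta>2"
        by (subst powr_mult) (auto simp: powr_minus simp del: distrib_left_numeral)
      also have "\<dots> \<le> 2 powr 1 * (real (\<kappa> (Suc n)) + 1) powr - \<delta>2"
        using A3_consts T_le[of n] by (intro mult_mono powr_mono powr_mono2') (auto simp: \<kappa>_Suc)
      finally show ?thesis
        using A3_consts(2) unfolding qa \<beta>_eq by (simp add: mult_ac)
    qed
    have "summable (\<lambda>n. \<beta> (\<kappa> n) * norm (E (\<kappa> n) \<omega>))"
    proof (rule summable_comparison_test')
      show "summable (\<lambda>n. q * (\<rho> n * a n * norm (E (\<kappa> n) \<omega>)))"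
        by (intro summable_mult elim)
      show "norm (\<beta> (\<kappa> n) * norm (E (\<kappa> n) \<omega>)) \<le> q * (\<rho> n * a n * norm (E (\<kappa> n) \<omega>))" if "0 \<le> n" for n
        using mult_right_mono[OF q[of n] norm_ge_zero[of "E (\<kappa> n) \<omega>"]] \<beta>_pos[of "\<kappa> n"]
        by (simp add: abs_mult mult_ac)
    qed
    then have sub: "summable (\<lambda>n. \<beta> ((Suc K + n) * T) * norm (E ((Suc K + n) * T) \<omega>))"
      by (simp only: \<kappa>_def)
    have KT: "K \<le> Suc K * T" using \<kappa>_ge[of 0] by (simp add: \<kappa>_def)
    show ?case
      using subsampled_weights_suffice[where v = "\<lambda>t. norm (E t \<omega>)" and b = \<beta>, OF _ _ _ C T _ KT \<beta>_sq \<beta>_div sub]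
        step1[OF _ elim(2)] \<beta>_pos \<beta>_mono by (simp add: less_imp_le decseq_def)
  qed

  \<comment> \<open>The two claims for individual nodes\<close>
  have E_ge: "norm (x i t \<omega> - y t \<omega>) \<le> norm (E t \<omega>)" for i t \<omega>
    using Finite_Cartesian_Product.norm_nth_le[of "E t \<omega>" i] by (simp add: E_def)
  show ?thesis
  proof (intro conjI allI)
    fix i
    show "AE \<omega> in M. (\<lambda>k. norm (x i k \<omega> - y k \<omega>)) \<longlonglongrightarrow> 0"
      using main
    proof eventually_elim
      case (elim \<omega>)
      show ?case
        by (rule Lim_null_comparison[OF _ conjunct2[OF elim]]) (simp add: E_ge)
    qed
    show "AE \<omega> in M. summable (\<lambda>k. \<beta> (Suc k) * norm (y (Suc k) \<omega> - x i (Suc k) \<omega>))"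
      using main
    proof eventually_elim
      case (elim \<omega>)
      then have "summable (\<lambda>k. \<beta> (Suc k) * norm (E (Suc k) \<omega>))"
        by (simp add: summable_Suc_iff[of "\<lambda>k. \<beta> k * norm (E k \<omega>)"])
      then show ?case
        by (rule summable_comparison_test')
          (use \<beta>_pos E_ge in \<open>auto simp: abs_mult norm_minus_commute less_imp_le intro!: mult_left_mono\<close>)
    qed
  qed
qed

end
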